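(* Let $z_1,\dots,z_J$ be distinct points of the unit circle, $\phi(z)=\prod_{j=1}^J(1-\overline{z_j}z)$, and let $(a_n)_{n\ge0}$ be a sequence of complex numbers with $a_n\ne1$ for all $n$. Let $H(K)$ be the reproducing kernel Hilbert space with orthonormal basis $f_n(z)=z^n\phi(a_nz)$, $n\ge0$. If $p>1/2$ and $\lim_{n\to\infty}n(1-a_n)=p$, then $z$ is a multiplier on $H(K)$.
   Context: $J\ge1$ is an integer. $K(z,\zeta)=\sum_{n=0}^\infty f_n(z)\overline{f_n(\zeta)}$ is the kernel of $H(K)$, and the elements of $H(K)$ are the functions $f=\sum_n\alpha_nf_n$ with $(\alpha_n)\in\ell^2$ and $\|f\|=\|(\alpha_n)\|_{\ell^2}$; they are analytic on the open unit disc $\mathbb{D}$ and are identified with their restrictions to $\mathbb{D}$. That $z$ is a multiplier on $H(K)$ means that $zf\in H(K)$ for every $f\in H(K)$, so that $f\mapsto zf$ is a bounded operator $M_z$ on $H(K)$. *)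

theory Defs
  imports "HOL-Analysis.Analysis"
begin

definition l2 :: "(nat \<Rightarrow> complex) set" where
  "l2 = {\<alpha>. summable (\<lambda>n. (cmod (\<alpha> n))\<^sup>2)}"

definition l2_norm :: "(nat \<Rightarrow> complex) \<Rightarrow> real" where
  "l2_norm \<alpha> = sqrt (\<Sum>n. (cmod (\<alpha> n))\<^sup>2)"

definition rkhs_kernel :: "(nat \<Rightarrow> complex \<Rightarrow> complex) \<Rightarrow> complex \<Rightarrow> complex \<Rightarrow> complex" where
  "rkhs_kernel e z \<zeta> = (\<Sum>n. e n z * cnj (e n \<zeta>))"

(* Functions on the unit disc are represented by total functions; all notions below depend
   only on the restriction of g to ball 0 1, the values of g elsewhere being arbitrary. *)
definition expands :: "(nat \<Rightarrow> complex \<Rightarrow> complex) \<Rightarrow> (nat \<Rightarrow> complex) \<Rightarrow> (complex \<Rightarrow> complex) \<Rightarrow> bool" where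
  "expands e \<alpha> g \<longleftrightarrow> \<alpha> \<in> l2 \<and> (\<forall>z\<in>ball 0 1. (\<lambda>n. \<alpha> n * e n z) sums g z)"

definition rkhs :: "(nat \<Rightarrow> complex \<Rightarrow> complex) \<Rightarrow> (complex \<Rightarrow> complex) set" where
  "rkhs e = {g. \<exists>\<alpha>. expands e \<alpha> g}"

(* The coefficients are meaningful only when the expansion is unique; this is proved below,
   as ex1_coeffs, for the functions considered here. *)
definition rkhs_coeffs :: "(nat \<Rightarrow> complex \<Rightarrow> complex) \<Rightarrow> (complex \<Rightarrow> complex) \<Rightarrow> nat \<Rightarrow> complex" where
  "rkhs_coeffs e g = (THE \<alpha>. expands e \<alpha> g)"

definition rkhs_norm :: "(nat \<Rightarrow> complex \<Rightarrow> complex) \<Rightarrow> (complex \<Rightarrow> complex) \<Rightarrow> real" where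
  "rkhs_norm e g = l2_norm (rkhs_coeffs e g)"

definition rkhs_inner ::
  "(nat \<Rightarrow> complex \<Rightarrow> complex) \<Rightarrow> (complex \<Rightarrow> complex) \<Rightarrow> (complex \<Rightarrow> complex) \<Rightarrow> complex" where
  "rkhs_inner e g h = (\<Sum>n. rkhs_coeffs e g n * cnj (rkhs_coeffs e h n))"

definition multiplier :: "(complex \<Rightarrow> complex) \<Rightarrow> (nat \<Rightarrow> complex \<Rightarrow> complex) \<Rightarrow> bool" where
  "multiplier h e \<longleftrightarrow> (\<forall>g\<in>rkhs e. (\<lambda>z. h z * g z) \<in> rkhs e)"

definition phi :: "nat \<Rightarrow> (nat \<Rightarrow> complex) \<Rightarrow> complex \<Rightarrow> complex" where
  "phi J w z = (\<Prod>j=1..J. 1 - cnj (w j) * z)"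

definition basis_fn :: "nat \<Rightarrow> (nat \<Rightarrow> complex) \<Rightarrow> (nat \<Rightarrow> complex) \<Rightarrow> nat \<Rightarrow> complex \<Rightarrow> complex" where
  "basis_fn J w a n z = z ^ n * phi J w (a n * z)"

lemma phi_bound:
  assumes "\<forall>j\<in>{1..J}. cmod (w j) = 1"
  shows "cmod (phi J w x) \<le> (1 + cmod x) ^ J"
proof -
  have "cmod (phi J w x) = (\<Prod>j=1..J. cmod (1 - cnj (w j) * x))"
    by (simp add: phi_def prod_norm)
  also have "\<dots> \<le> (\<Prod>j=1..J. 1 + cmod x)"
  proof (rule prod_mono, intro conjI)
    fix j assume "j \<in> {1..J}"
    then have "cmod (cnj (w j) * x) = cmod x"
      using assms by (simp add: norm_mult)
    then show "cmod (1 - cnj (w j) * x) \<le> 1 + cmod x"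
      by (metis norm_one norm_triangle_ineq4)
  qed simp
  finally show ?thesis by simp
qed

lemma phi_dilate_bounded:
  assumes w: "\<forall>j\<in>{1..J}. cmod (w j) = 1" and a: "Bseq a"
  obtains M where "M > 0" "\<And>n z. cmod z \<le> 1 \<Longrightarrow> cmod (phi J w (a n * z)) \<le> M"
proof -
  obtain B where B: "B > 0" "\<And>n. cmod (a n) \<le> B"
    using a by (auto simp: Bseq_def)
  show ?thesis
  proof (rule that[of "(1 + B) ^ J"])
    fix n and z :: complex assume z: "cmod z \<le> 1"
    have "cmod (a n * z) \<le> B * 1"
      unfolding norm_mult using B z by (intro mult_mono) (auto intro: less_imp_le)
    then have "(1 + cmod (a n * z)) ^ J \<le> (1 + B) ^ J"
      by (intro power_mono) auto
    then show "cmod (phi J w (a n * z)) \<le> (1 + B) ^ J"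
      using phi_bound[OF w, of "a n * z"] by linarith
  qed (use B in auto)
qed

lemma l2_coeff_bounded:
  assumes "\<alpha> \<in> l2"
  obtains C where "C > 0" "\<And>n. cmod (\<alpha> n) \<le> C"
proof -
  have "(\<lambda>n. (cmod (\<alpha> n))\<^sup>2) \<longlonglongrightarrow> 0"
    using assms unfolding l2_def mem_Collect_eq by (rule summable_LIMSEQ_zero)
  then have "Bseq (\<lambda>n. (cmod (\<alpha> n))\<^sup>2)"
    by (metis Bseq_conv_Bfun convergentI convergent_imp_Bseq)
  then obtain K where K: "K > 0" "\<And>n. (cmod (\<alpha> n))\<^sup>2 \<le> K"
    by (auto simp: Bseq_def)
  show ?thesis
    by (rule that[of "sqrt K"]) (use K real_le_rsqrt in auto)
qed

lemma unique_expansion_zero: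
  assumes w: "\<forall>j\<in>{1..J}. cmod (w j) = 1" and a: "Bseq a"
    and b: "\<And>n. cmod (\<beta> n) \<le> C"
    and s: "\<And>z. z \<in> ball 0 1 \<Longrightarrow> (\<lambda>n. \<beta> n * basis_fn J w a n z) sums 0"
  shows "\<beta> m = 0"
proof (induction m rule: less_induct)
  case (less m)
  obtain M where M: "M > 0" "\<And>n z. cmod z \<le> 1 \<Longrightarrow> cmod (phi J w (a n * z)) \<le> M"
    using phi_dilate_bounded[OF w a] by metis
  have C: "C \<ge> 0"
    using b[of 0] norm_ge_zero order_trans by blast
  have bd: "cmod (\<beta> m * phi J w (a m * of_real x)) \<le> x * (2 * (C * M))"
    if x: "0 < x" "x < 1/2" for x :: real
  proof -
    define z :: complex where "z = of_real x"
    have z: "z \<noteq> 0" "cmod z = x" "z \<in> ball 0 1"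
      using x by (auto simp: z_def)
    define c where "c = (\<lambda>n. \<beta> n * phi J w (a n * z))"
    have cb: "cmod (c n) \<le> C * M" for n
      unfolding c_def norm_mult using b M z x C by (intro mult_mono) auto
    have "(\<lambda>n. c n * z ^ n) sums 0"
      using s[OF z(3)] by (simp add: c_def basis_fn_def mult_ac)
    moreover have "(\<Sum>i<m. c i * z ^ i) = 0"
      using less by (simp add: c_def)
    ultimately have "(\<lambda>n. c (n + m) * z ^ (n + m)) sums 0"
      using sums_iff_shift[of "\<lambda>n. c n * z ^ n" m 0] by simp
    then have "(\<lambda>n. (c (n + m) * z ^ (n + m)) / z ^ m) sums (0 / z ^ m)"
      by (rule sums_divide)
    then have "(\<lambda>n. c (n + m) * z ^ n) sums 0"
      using z by (simp add: power_add)
    then have "(\<lambda>n. c (Suc n + m) * z ^ Suc n) sums (- c m)"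
      using sums_Suc_iff[of "\<lambda>n. c (n + m) * z ^ n" "- c m"] by simp
    then have e: "- c m = (\<Sum>n. c (Suc n + m) * z ^ Suc n)"
      by (rule sums_unique)
    have g: "(\<lambda>n. (C * M * x) * x ^ n) sums ((C * M * x) * (1 / (1 - x)))"
      using x by (intro sums_mult geometric_sums) auto
    have t: "cmod (c (Suc n + m) * z ^ Suc n) \<le> (C * M * x) * x ^ n" for n
    proof -
      have "cmod (c (Suc n + m) * z ^ Suc n) = cmod (c (Suc n + m)) * x ^ Suc n"
        by (simp add: norm_mult norm_power z(2) del: power_Suc)
      also have "\<dots> \<le> (C * M) * x ^ Suc n"
        using cb x by (intro mult_right_mono) auto
      finally show ?thesis by simp
    qed
    have "cmod (c m) = cmod (- c m)"
      by simp
    also have "\<dots> \<le> (\<Sum>n. (C * M * x) * x ^ n)"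
      unfolding e by (rule norm_suminf_le[OF t]) (use g in \<open>simp add: sums_iff\<close>)
    also have "\<dots> = (C * M * x) * (1 / (1 - x))"
      using g by (simp add: sums_iff)
    also have "\<dots> \<le> (C * M * x) * 2"
      using x C M by (intro mult_left_mono) (auto simp: field_simps)
    finally show ?thesis
      by (simp add: c_def z_def mult_ac)
  qed
  have "((\<lambda>x::real. cmod (\<beta> m * phi J w (a m * of_real x))) \<longlongrightarrow>
      cmod (\<beta> m * phi J w (a m * of_real 0))) (at_right 0)"
    unfolding phi_def by (intro tendsto_intros)
  moreover have "((\<lambda>x::real. x * (2 * (C * M))) \<longlongrightarrow> 0 * (2 * (C * M))) (at_right 0)"
    by (intro tendsto_intros)
  moreover have "\<forall>\<^sub>F x::real in at_right 0.
      cmod (\<beta> m * phi J w (a m * of_real x)) \<le> x * (2 * (C * M))"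
    using bd by (intro eventually_at_rightI[of 0 "1/2"]) auto
  ultimately have "cmod (\<beta> m * phi J w (a m * of_real 0)) \<le> 0 * (2 * (C * M))"
    using tendsto_le[OF trivial_limit_at_right_real] by blast
  then show "\<beta> m = 0"
    by (simp add: phi_def)
qed

lemma expands_unique:
  assumes w: "\<forall>j\<in>{1..J}. cmod (w j) = 1" and a: "Bseq a"
    and 1: "expands (basis_fn J w a) \<alpha> g" and 2: "expands (basis_fn J w a) \<beta> g"
  shows "\<alpha> = \<beta>"
proof
  fix m
  obtain C where C: "\<And>n. cmod (\<alpha> n) \<le> C"
    using 1 l2_coeff_bounded unfolding expands_def by metis
  obtain D where D: "\<And>n. cmod (\<beta> n) \<le> D"
    using 2 l2_coeff_bounded unfolding expands_def by metis
  have "\<alpha> m - \<beta> m = 0"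
  proof (rule unique_expansion_zero[OF w a])
    show "cmod (\<alpha> n - \<beta> n) \<le> C + D" for n
      using C[of n] D[of n] norm_triangle_ineq4[of "\<alpha> n" "\<beta> n"] by linarith
    fix z :: complex assume "z \<in> ball 0 1"
    then have "(\<lambda>n. \<alpha> n * basis_fn J w a n z) sums g z" "(\<lambda>n. \<beta> n * basis_fn J w a n z) sums g z"
      using 1 2 unfolding expands_def by blast+
    from sums_diff[OF this] show "(\<lambda>n. (\<alpha> n - \<beta> n) * basis_fn J w a n z) sums 0"
      by (simp add: left_diff_distrib)
  qed
  then show "\<alpha> m = \<beta> m" by simp
qed

lemma ex1_coeffs:
  assumes "\<forall>j\<in>{1..J}. cmod (w j) = 1" and "Bseq a" and "g \<in> rkhs (basis_fn J w a)"
  shows "\<exists>!\<alpha>. expands (basis_fn J w a) \<alpha> g"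
  using assms expands_unique unfolding rkhs_def by blast

lemma rkhs_coeffs_eq:
  assumes "\<forall>j\<in>{1..J}. cmod (w j) = 1" and "Bseq a" and "expands (basis_fn J w a) \<alpha> g"
  shows "rkhs_coeffs (basis_fn J w a) g = \<alpha>"
  unfolding rkhs_coeffs_def using assms expands_unique by blast

lemma basis_fn_orthonormal:
  assumes "\<forall>j\<in>{1..J}. cmod (w j) = 1" and "Bseq a"
  shows "basis_fn J w a m \<in> rkhs (basis_fn J w a)"
    and "rkhs_inner (basis_fn J w a) (basis_fn J w a m) (basis_fn J w a n) = (if m = n then 1 else 0)"
proof -
  have u: "expands (basis_fn J w a) (\<lambda>i. if i = k then 1 else 0) (basis_fn J w a k)" for k
  proof -
    have "(\<lambda>i. (cmod (if i = k then 1 else 0))\<^sup>2) = (\<lambda>i. if i = k then 1 else 0)"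
      by auto
    then have "(\<lambda>i. if i = k then 1 else 0) \<in> l2"
      using sums_single[of k "\<lambda>_. 1 :: real"] by (simp add: l2_def sums_iff)
    moreover have "(\<lambda>i. (if i = k then 1 else 0) * basis_fn J w a i z) =
        (\<lambda>i. if i = k then basis_fn J w a i z else 0)" for z
      by auto
    ultimately show ?thesis
      using sums_single[of k "\<lambda>i. basis_fn J w a i _"] by (auto simp: expands_def)
  qed
  then show "basis_fn J w a m \<in> rkhs (basis_fn J w a)"
    by (auto simp: rkhs_def)
  have "(\<lambda>i. (if i = m then 1 else 0) * cnj (if i = n then 1 else 0)) =
      (\<lambda>i. if i = m then (if m = n then 1 else 0) else 0)"
    by auto
  then show "rkhs_inner (basis_fn J w a) (basis_fn J w a m) (basis_fn J w a n) = (if m = n then 1 else 0)"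
    unfolding rkhs_inner_def rkhs_coeffs_eq[OF assms u]
    using sums_single[of m "\<lambda>_. if m = n then 1 else 0 :: complex"] by (simp add: sums_iff)
qed

lemma basis_fn_l2:
  assumes w: "\<forall>j\<in>{1..J}. cmod (w j) = 1" and a: "Bseq a" and z: "z \<in> ball 0 1"
  shows "(\<lambda>n. cnj (basis_fn J w a n z)) \<in> l2"
proof -
  obtain M where M: "M > 0" "\<And>n z. cmod z \<le> 1 \<Longrightarrow> cmod (phi J w (a n * z)) \<le> M"
    using phi_dilate_bounded[OF w a] by metis
  have "summable (\<lambda>n. M\<^sup>2 * ((cmod z)\<^sup>2) ^ n)"
    using z by (intro summable_mult summable_geometric) (simp add: power_less_one_iff)
  moreover have "norm ((cmod (cnj (basis_fn J w a n z)))\<^sup>2) \<le> M\<^sup>2 * ((cmod z)\<^sup>2) ^ n" for n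
  proof -
    have "(cmod (phi J w (a n * z)))\<^sup>2 \<le> M\<^sup>2"
      using M z by (intro power_mono) auto
    then have "((cmod z)\<^sup>2) ^ n * (cmod (phi J w (a n * z)))\<^sup>2 \<le> ((cmod z)\<^sup>2) ^ n * M\<^sup>2"
      by (intro mult_left_mono) auto
    then show ?thesis
      by (simp add: basis_fn_def norm_mult norm_power power_mult_distrib power_mult[symmetric] mult_ac)
  qed
  ultimately show ?thesis
    unfolding l2_def mem_Collect_eq by (rule summable_comparison_test'[where N = 0])
qed

lemma reproducing:
  assumes w: "\<forall>j\<in>{1..J}. cmod (w j) = 1" and a: "Bseq a"
    and g: "g \<in> rkhs (basis_fn J w a)" and \<zeta>: "\<zeta> \<in> ball 0 1"
  shows "(\<lambda>z. rkhs_kernel (basis_fn J w a) z \<zeta>) \<in> rkhs (basis_fn J w a)"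
    and "rkhs_inner (basis_fn J w a) g (\<lambda>z. rkhs_kernel (basis_fn J w a) z \<zeta>) = g \<zeta>"
proof -
  let ?e = "basis_fn J w a"
  have k: "expands ?e (\<lambda>n. cnj (?e n \<zeta>)) (\<lambda>z. rkhs_kernel ?e z \<zeta>)"
    unfolding expands_def
  proof (intro conjI ballI basis_fn_l2[OF w a \<zeta>])
    fix z :: complex assume z: "z \<in> ball 0 1"
    have "summable (\<lambda>n. ((cmod (?e n z))\<^sup>2 + (cmod (?e n \<zeta>))\<^sup>2) / 2)"
      using basis_fn_l2[OF w a z] basis_fn_l2[OF w a \<zeta>]
      by (intro summable_divide summable_add) (auto simp: l2_def)
    moreover have "norm (cnj (?e n \<zeta>) * ?e n z) \<le> ((cmod (?e n z))\<^sup>2 + (cmod (?e n \<zeta>))\<^sup>2) / 2" for n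
      using sum_squares_bound[of "cmod (?e n z)" "cmod (?e n \<zeta>)"] by (simp add: norm_mult mult_ac)
    ultimately have "summable (\<lambda>n. cnj (?e n \<zeta>) * ?e n z)"
      by (rule summable_comparison_test'[where N = 0])
    then show "(\<lambda>n. cnj (?e n \<zeta>) * ?e n z) sums rkhs_kernel ?e z \<zeta>"
      unfolding rkhs_kernel_def by (simp add: summable_sums mult.commute)
  qed
  then show "(\<lambda>z. rkhs_kernel ?e z \<zeta>) \<in> rkhs ?e"
    by (auto simp: rkhs_def)
  obtain \<alpha> where \<alpha>: "expands ?e \<alpha> g"
    using g by (auto simp: rkhs_def)
  then have "(\<lambda>n. \<alpha> n * ?e n \<zeta>) sums g \<zeta>"
    using \<zeta> by (auto simp: expands_def)
  then show "rkhs_inner ?e g (\<lambda>z. rkhs_kernel ?e z \<zeta>) = g \<zeta>"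
    unfolding rkhs_inner_def rkhs_coeffs_eq[OF w a k] rkhs_coeffs_eq[OF w a \<alpha>]
    by (simp add: sums_iff)
qed

end

theory Submission
  imports Defs "HOL-Computational_Algebra.Polynomial_FPS"
begin

text \<open>
  Why multiplication by \<open>z\<close> is bounded. Write \<open>\<phi>(x) = \<Sum>k. c\<^sub>k x\<^sup>k = \<Prod>j. (1 - l\<^sub>j x)\<close>
  with \<open>l\<^sub>j\<close> the conjugate of \<open>w j\<close>. From \<open>z f\<^sub>n = f\<^sub>n\<^sub>+\<^sub>1 + z\<^sup>n\<^sup>+\<^sup>1 (\<phi>(a\<^sub>n z) - \<phi>(a\<^sub>n\<^sub>+\<^sub>1 z))\<close>,
  multiplication by \<open>z\<close> is the shift of the basis, which is an isometry, up to a remainder. The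
  Taylor coefficients \<open>h\<^sub>m\<close> of the remainder are \<open>O(1/m)\<close> times a convolution of the given
  coefficients \<open>\<alpha>\<close> with a finite kernel, because \<open>n (1 - a\<^sub>n)\<close> converges. It remains to expand
  the remainder in the \<open>f\<^sub>n\<close>, that is, to solve the triangular recurrence
  \<open>\<Sum>k\<le>m. c\<^sub>k a\<^sub>m\<^sub>-\<^sub>k\<^sup>k \<beta>\<^sub>m\<^sub>-\<^sub>k = h\<^sub>m\<close> with an \<open>\<ell>\<^sup>2\<close> bound on \<open>\<beta>\<close>.

  As \<open>a\<^sub>n = 1 - p/n + o(1/n)\<close>, this recurrence is a perturbation of size \<open>1/m\<close> of the one with
  characteristic roots \<open>l\<^sub>j\<close>. Its modes are \<open>y\<^sub>j = Q\<^sub>j(S) \<beta>\<close>, where \<open>S\<close> is the backward shift of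
  indices and \<open>Q\<^sub>j\<close> is \<open>\<phi>\<close> without its \<open>j\<close>-th factor, since \<open>(1 - l\<^sub>j S) y\<^sub>j = \<phi>(S) \<beta>\<close>. The
  first-order term is governed by \<open>\<phi>' = - \<Sum>i. l\<^sub>i Q\<^sub>i\<close>, which gives
  \<open>y\<^sub>j(m+1) = l\<^sub>j y\<^sub>j(m) - p/(m+1) \<Sum>i. l\<^sub>i y\<^sub>i(m) + h\<^sub>m\<^sub>+\<^sub>1 + o(1/m)\<close>.
  The \<open>l\<^sub>j\<close> being distinct, a change of variables of size \<open>1/m\<close> removes the terms with
  \<open>i \<noteq> j\<close>. Every mode is then damped by a factor \<open>1 - p/(m+1)\<close> at each step, up to
  \<open>o(1/m)\<close>, so the solution operator is dominated, up to a constant, by \<open>\<Sum>n\<le>m. (n/m)\<^sup>q \<bar>h\<^sub>n\<bar>\<close> with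
  \<open>1/2 < q < p\<close>. That this maps sequences with \<open>(n h\<^sub>n)\<close> in \<open>\<ell>\<^sup>2\<close> into \<open>\<ell>\<^sup>2\<close> is a Hardy
  inequality, and it is the place where \<open>p > 1/2\<close> enters.

  The Hardy inequality is \<open>discrete_hardy\<close>, the decoupling of the modes is
  \<open>perturbed_rotation_l2_bound\<close>, the bound on \<open>\<beta>\<close> is \<open>recurrence_l2_bound\<close>, and the estimate of
  \<open>h\<close> is part of \<open>shifted_coefficients\<close>.
\<close>

section \<open>Damped recurrences and a Hardy inequality\<close>

text \<open>
  A weighted energy argument: multiplying the squared step by \<open>m + 1\<close> turns the damping into
  \<open>(m + 1) U(m+1)\<^sup>2 \<le> m U(m)\<^sup>2 - (2 q - 1) U(m)\<^sup>2 + \<dots>\<close>, so that for \<open>q > 1/2\<close> the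
  telescoping sum controls \<open>\<Sum>m. U(m)\<^sup>2\<close>. The lower bounds on \<open>N\<close> make the error
  \<open>q\<^sup>2/(m+1)\<close> at most half of the gain and keep the damping factor nonnegative.
\<close>

lemma discrete_hardy:
  fixes U G :: "nat \<Rightarrow> real" and q :: real
  assumes q: "q > 1/2" and U: "\<And>m. U m \<ge> 0" and G: "\<And>m. G m \<ge> 0"
    and N: "real N \<ge> 2 * q\<^sup>2 / (2 * q - 1)" "real N \<ge> q"
    and step: "\<And>m. m \<ge> N \<Longrightarrow> U (Suc m) \<le> (1 - q / real (Suc m)) * U m + G (Suc m)"
  defines "d \<equiv> 2 * q - 1"
  shows "d / 4 * (\<Sum>m=N..<M. (U m)\<^sup>2)
    \<le> real N * (U N)\<^sup>2 + (1 + 4 / d) * (\<Sum>m=N..<M. (real (Suc m) * G (Suc m))\<^sup>2)"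
proof -
  have d: "d > 0" using q by (simp add: d_def)
  have one: "real (Suc m) * (U (Suc m))\<^sup>2 + d / 4 * (U m)\<^sup>2
      \<le> real m * (U m)\<^sup>2 + (1 + 4 / d) * (real (Suc m) * G (Suc m))\<^sup>2" if m: "m \<ge> N" for m
  proof -
    define k where "k = real (Suc m)"
    define x where "x = U m"
    define v where "v = k * G (Suc m)"
    have k: "k \<ge> 1" "k \<ge> q" "k \<ge> 2 * q\<^sup>2 / d"
      using m N by (auto simp: k_def d_def)
    have x: "x \<ge> 0" and v: "v \<ge> 0"
      using U G k by (auto simp: x_def v_def)
    have qk: "q\<^sup>2 / k \<le> d / 2"
      using k d by (simp add: field_simps)
    have vk: "v\<^sup>2 / k \<le> v\<^sup>2"
      using k mult_right_mono[of 1 k "v\<^sup>2"] by (simp add: field_simps)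
    have "k * U (Suc m) \<le> k * ((1 - q / k) * x + G (Suc m))"
      using step[OF m] k by (intro mult_left_mono) (auto simp: k_def x_def)
    also have "\<dots> = (k - q) * x + v"
      using k by (simp add: v_def field_simps)
    finally have le: "k * U (Suc m) \<le> (k - q) * x + v" .
    have "k * (k * (U (Suc m))\<^sup>2) = (k * U (Suc m))\<^sup>2"
      by (simp add: power2_eq_square)
    also have "\<dots> \<le> ((k - q) * x + v)\<^sup>2"
      using le U k by (intro power_mono) auto
    finally have "k * (U (Suc m))\<^sup>2 \<le> ((k - q) * x + v)\<^sup>2 / k"
      using k by (simp add: field_simps)
    also have "\<dots> = (k - 2 * q + q\<^sup>2 / k) * x\<^sup>2 + (1 - q / k) * (2 * x * v) + v\<^sup>2 / k"
      using k by (simp add: field_simps power2_eq_square)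
    also have "\<dots> \<le> (k - 2 * q + d / 2) * x\<^sup>2 + 1 * (2 * x * v) + v\<^sup>2"
      using qk vk k q x v by (intro add_mono mult_right_mono) auto
    also have "2 * x * v \<le> d / 4 * x\<^sup>2 + 4 / d * v\<^sup>2"
    proof -
      have "0 \<le> (d / 4 * x - v)\<^sup>2 * (4 / d)"
        using d by simp
      also have "\<dots> = d / 4 * x\<^sup>2 + 4 / d * v\<^sup>2 - 2 * x * v"
        using d by (simp add: field_simps power2_eq_square)
      finally show ?thesis by simp
    qed
    finally have "k * (U (Suc m))\<^sup>2 \<le> (k - 2 * q + d / 2) * x\<^sup>2 + 1 * (d / 4 * x\<^sup>2 + 4 / d * v\<^sup>2) + v\<^sup>2"
      by simp
    also have "\<dots> = (k - 1) * x\<^sup>2 - d / 4 * x\<^sup>2 + (1 + 4 / d) * v\<^sup>2"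
      using d by (simp add: d_def field_simps)
    finally show ?thesis
      by (simp add: k_def x_def v_def)
  qed
  have "M \<ge> N \<Longrightarrow> real M * (U M)\<^sup>2 + d / 4 * (\<Sum>m=N..<M. (U m)\<^sup>2)
    \<le> real N * (U N)\<^sup>2 + (1 + 4 / d) * (\<Sum>m=N..<M. (real (Suc m) * G (Suc m))\<^sup>2)" for M
  proof (induction M rule: dec_induct)
    case (step m)
    then show ?case
      using one[of m] by (simp add: distrib_left del: of_nat_Suc)
  qed simp
  moreover have "0 \<le> real M * (U M)\<^sup>2" for M by simp
  ultimately show ?thesis
    by (cases "M \<ge> N") (smt (verit) d, use d in simp)
qed

text \<open>
  The off-diagonal terms \<open>- p/(m+1) l\<^sub>i y\<^sub>i\<close> with \<open>i \<noteq> j\<close> oscillate relative to the rotation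
  \<open>l\<^sub>j\<close> and average out. The averaging is done by one step of a normal form: the new variables
  are \<open>Y\<^sub>j(m) = y\<^sub>j(m) + (1/m) \<Sum>i. T\<^sub>j\<^sub>i y\<^sub>i(m)\<close>, and the term with \<open>l\<^sub>i\<close> disappears
  from the equation of \<open>Y\<^sub>j\<close> exactly when \<open>T\<^sub>j\<^sub>i l\<^sub>i = p l\<^sub>i + l\<^sub>j T\<^sub>j\<^sub>i\<close>. What is left is
  \<open>Y\<^sub>j(m+1) = l\<^sub>j (1 - p/(m+1)) Y\<^sub>j(m)\<close> up to \<open>O(1/m\<^sup>2)\<close> and the admitted errors.
  The tolerance \<open>\<eta>\<close> depends only on the data \<open>l\<close> and \<open>p\<close>, so that it can absorb any error
  of size \<open>o(1/m)\<close> from some index on.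
\<close>

lemma perturbed_rotation_l2_bound:
  fixes l :: "'i \<Rightarrow> complex" and p :: real
  assumes I: "finite I" and inj: "inj_on l I" and unit: "\<forall>i\<in>I. cmod (l i) = 1"
    and p: "p > 1/2"
  shows "\<exists>\<eta> N\<^sub>0 C. \<eta> > 0 \<and> C \<ge> 0 \<and> (\<forall>N\<ge>N\<^sub>0. \<forall>M y. \<forall>g :: nat \<Rightarrow> real. (\<forall>m. g m \<ge> 0) \<longrightarrow>
      (\<forall>m\<ge>N. \<forall>j\<in>I. cmod (y j (Suc m) - l j * y j m + p / Suc m * (\<Sum>i\<in>I. l i * y i m))
          \<le> g (Suc m) + \<eta> / Suc m * (\<Sum>i\<in>I. cmod (y i m))) \<longrightarrow>
      (\<Sum>m=N..<M. (\<Sum>i\<in>I. cmod (y i m))\<^sup>2)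
        \<le> C * (N * (\<Sum>i\<in>I. cmod (y i N))\<^sup>2 + (\<Sum>m=N..<M. (Suc m * g (Suc m))\<^sup>2)))"
proof -
  have l: "cmod (l i) = 1" if "i \<in> I" for i using unit that by blast
  define n where "n = real (card I)"
  \<comment> \<open>The gap between \<open>p\<close> and \<open>q\<close> is spent on the error terms, the gap between \<open>q\<close> and
    \<open>1/2\<close> on the Hardy inequality.\<close>
  define q where "q = (p + 1/2) / 2"
  define \<eta> where "\<eta> = (p - q) / (8 * n + 1)"
  \<comment> \<open>Division by zero makes the diagonal entries vanish, as they should.\<close>
  define T where "T = (\<lambda>j i. p * l i / (l i - l j))"
  define \<tau> where "\<tau> = (\<Sum>j\<in>I. \<Sum>i\<in>I. cmod (T j i))"
  define d where "d = 2 * q - 1"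
  have n: "n \<ge> 0" and q: "q > 1/2" "q < p"
    using p by (auto simp: n_def q_def)
  then have \<eta>: "\<eta> > 0" and d: "d > 0"
    by (auto simp: \<eta>_def d_def)
  have n\<eta>: "8 * n * \<eta> \<le> p - q"
    using n q by (simp add: \<eta>_def field_simps)
  have \<tau>: "\<tau> \<ge> 0"
    unfolding \<tau>_def by (intro sum_nonneg) auto
  obtain N\<^sub>0 :: nat where N\<^sub>0: "real N\<^sub>0 \<ge> 2 * \<tau> + \<tau> * \<bar>p - 1\<bar> / \<eta> + p * \<tau> / \<eta> + p
      + 2 * q\<^sup>2 / (2 * q - 1) + 1"
    using real_arch_simple by blast
  define C where "C = 4 / d * (4 + (1 + 4 / d) * (2 * n)\<^sup>2) * 4"
  show ?thesis
  proof (rule exI[of _ \<eta>], rule exI[of _ N\<^sub>0], rule exI[of _ C], intro conjI allI impI)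
    show "C \<ge> 0" using d n by (simp add: C_def)
    fix N M :: nat and y :: "'i \<Rightarrow> nat \<Rightarrow> complex" and g :: "nat \<Rightarrow> real"
    assume N: "N\<^sub>0 \<le> N" and g': "\<forall>m. g m \<ge> 0"
      and H: "\<forall>m\<ge>N. \<forall>j\<in>I. cmod (y j (Suc m) - l j * y j m + p / Suc m * (\<Sum>i\<in>I. l i * y i m))
          \<le> g (Suc m) + \<eta> / Suc m * (\<Sum>i\<in>I. cmod (y i m))"
    have g: "g m \<ge> 0" for m using g' by blast
    define s where "s = (\<lambda>m. \<Sum>i\<in>I. cmod (y i m))"
    define Z where "Z = (\<lambda>j m. \<Sum>i\<in>I. T j i * y i m)"
    define Y where "Y = (\<lambda>j m. y j m + Z j m / of_nat m)"
    define U where "U = (\<lambda>m. \<Sum>j\<in>I. cmod (Y j m))"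
    have s: "s m \<ge> 0" for m
      unfolding s_def by (intro sum_nonneg) auto
    have U: "U m \<ge> 0" for m
      unfolding U_def by (intro sum_nonneg) auto
    have Tbound: "(\<Sum>i\<in>I. cmod (T j i)) \<le> \<tau>" if "j \<in> I" for j
      unfolding \<tau>_def using I that by (intro member_le_sum) (auto intro: sum_nonneg)
    have Tle: "cmod (T j i) \<le> \<tau>" if "j \<in> I" "i \<in> I" for i j
      using member_le_sum[of i I "\<lambda>i. cmod (T j i)"] I that Tbound[of j] by force
    have Zle: "cmod (Z j m) \<le> \<tau> * s m" if "j \<in> I" for j m
      unfolding Z_def s_def sum_distrib_left
      by (rule order_trans[OF norm_sum])
        (auto simp: norm_mult intro!: sum_mono mult_right_mono Tle that)
    have Zsum: "(\<Sum>j\<in>I. cmod (Z j m)) \<le> \<tau> * s m" for m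
    proof -
      have "cmod (Z j m) \<le> (\<Sum>i\<in>I. cmod (T j i)) * s m" for j
      proof -
        have "cmod (Z j m) \<le> (\<Sum>i\<in>I. cmod (T j i) * cmod (y i m))"
          unfolding Z_def by (rule order_trans[OF norm_sum]) (simp add: norm_mult)
        also have "\<dots> \<le> (\<Sum>i\<in>I. cmod (T j i) * s m)"
          unfolding s_def using I by (intro sum_mono mult_left_mono member_le_sum) auto
        finally show ?thesis by (simp add: sum_distrib_right)
      qed
      then show ?thesis
        unfolding \<tau>_def sum_distrib_right by (intro sum_mono)
    qed
    have big: "\<tau> / real m \<le> 1/2" "\<tau> * \<bar>p - 1\<bar> / real m \<le> \<eta>" "p * \<tau> / real m \<le> \<eta>"
      "p / real m \<le> 1" "real m > 0" "real m \<ge> 2 * q\<^sup>2 / (2 * q - 1)" "real m \<ge> q" if "m \<ge> N" for m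
    proof -
      have m: "real m \<ge> 2 * \<tau> + \<tau> * \<bar>p - 1\<bar> / \<eta> + p * \<tau> / \<eta> + p + 2 * q\<^sup>2 / (2 * q - 1) + 1"
        using N that N\<^sub>0 by linarith
      have nn: "\<tau> * \<bar>p - 1\<bar> / \<eta> \<ge> 0" "p * \<tau> / \<eta> \<ge> 0" "2 * q\<^sup>2 / (2 * q - 1) \<ge> 0"
        using \<tau> \<eta> p q by auto
      show "real m > 0" "real m \<ge> 2 * q\<^sup>2 / (2 * q - 1)" "real m \<ge> q"
        using m nn \<tau> p q by linarith+
      have "2 * \<tau> \<le> m" "\<tau> * \<bar>p - 1\<bar> / \<eta> \<le> m" "p * \<tau> / \<eta> \<le> m" "p \<le> m"
        using m nn \<tau> p by linarith+
      then show "\<tau> / real m \<le> 1/2" "\<tau> * \<bar>p - 1\<bar> / real m \<le> \<eta>" "p * \<tau> / real m \<le> \<eta>"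
        "p / real m \<le> 1"
        using \<open>real m > 0\<close> \<eta> by (auto simp: field_simps)
    qed
    have Ys: "U m \<le> 2 * s m" "s m \<le> 2 * U m" if m: "m \<ge> N" for m
    proof -
      have "(\<Sum>j\<in>I. cmod (Z j m / of_nat m)) = (\<Sum>j\<in>I. cmod (Z j m)) / m"
        by (simp add: norm_divide sum_divide_distrib)
      also have "\<dots> \<le> \<tau> * s m / m"
        using Zsum by (intro divide_right_mono) auto
      also have "\<dots> \<le> 1/2 * s m"
        using big(1)[OF m] s[of m] mult_right_mono[of "\<tau> / m" "1/2" "s m"] by simp
      finally have Z2: "(\<Sum>j\<in>I. cmod (Z j m / of_nat m)) \<le> 1/2 * s m" .
      have "U m \<le> s m + (\<Sum>j\<in>I. cmod (Z j m / of_nat m))"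
        unfolding U_def s_def Y_def sum.distrib[symmetric] by (intro sum_mono norm_triangle_ineq)
      then show "U m \<le> 2 * s m" using Z2 s[of m] by linarith
      have "cmod (y j m) \<le> cmod (Y j m) + cmod (Z j m / of_nat m)" for j
        using norm_triangle_ineq4[of "Y j m" "Z j m / of_nat m"] by (simp add: Y_def)
      then have "s m \<le> U m + (\<Sum>j\<in>I. cmod (Z j m / of_nat m))"
        unfolding U_def s_def sum.distrib[symmetric] by (intro sum_mono)
      then show "s m \<le> 2 * U m" using Z2 by linarith
    qed
    have Ystep: "cmod (Y j (Suc m)) \<le> (1 - p / Suc m) * cmod (Y j m) + 2 * g (Suc m)
        + 4 * \<eta> / Suc m * s m" if m: "m \<ge> N" and j: "j \<in> I" for m j
    proof -
      define t where "t = 1 / real (Suc m)"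
      define r where "r = 1 / real m"
      define L where "L = (\<Sum>i\<in>I. l i * y i m)"
      define \<rho> where "\<rho> = (\<lambda>i. y i (Suc m) - l i * y i m + p * t * L)"
      have m0: "real m > 0" using big[OF m] by simp
      have t: "t > 0" "t \<le> r" "r > 0" "r - t = r * t" "t - r = - (r * t)"
        using m0 by (auto simp: t_def r_def field_simps)
      have \<rho>: "cmod (\<rho> i) \<le> g (Suc m) + \<eta> * t * s m" if "i \<in> I" for i
        using H m that by (simp add: \<rho>_def L_def t_def s_def)
      have yS: "y i (Suc m) = l i * y i m - p * t * L + \<rho> i" for i
        by (simp add: \<rho>_def)
      have Lle: "cmod L \<le> s m"
        unfolding L_def s_def by (rule order_trans[OF norm_sum]) (simp add: norm_mult l)
      \<comment> \<open>The equation that determines \<open>T\<close>.\<close>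
      have Tl: "T j i * l i = p * l i + l j * T j i - (if i = j then p * l j else 0)" if "i \<in> I" for i
      proof (cases "i = j")
        case False
        then have "l i - l j \<noteq> 0" using inj that j by (auto dest: inj_onD)
        then show ?thesis using False by (simp add: T_def field_simps)
      qed (simp add: T_def)
      have "(\<Sum>i\<in>I. T j i * (l i * y i m)) =
          (\<Sum>i\<in>I. p * (l i * y i m) + l j * (T j i * y i m) - (if i = j then p * l j * y j m else 0))"
      proof (rule sum.cong)
        fix i assume "i \<in> I"
        have "T j i * (l i * y i m) = (T j i * l i) * y i m" by simp
        also have "\<dots> = p * (l i * y i m) + l j * (T j i * y i m) - (if i = j then p * l j * y j m else 0)"
          unfolding Tl[OF \<open>i \<in> I\<close>] by (auto simp: algebra_simps)
        finally show "T j i * (l i * y i m) = \<dots>" .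
      qed simp
      also have "\<dots> = p * L + l j * Z j m - p * l j * y j m"
        using I j by (simp add: sum.distrib sum_subtractf L_def Z_def sum_distrib_left)
      finally have TL: "(\<Sum>i\<in>I. T j i * (l i * y i m)) = p * L + l j * Z j m - p * l j * y j m" .
      define S where "S = (\<Sum>i\<in>I. T j i * (\<rho> i - p * t * L))"
      have ZS: "Z j (Suc m) = p * L + l j * Z j m - p * l j * y j m + S"
        unfolding TL[symmetric] unfolding S_def Z_def sum.distrib[symmetric] yS
        by (intro sum.cong) (auto simp: algebra_simps)
      have "Y j (Suc m) = y j (Suc m) + t * Z j (Suc m)"
        by (simp add: Y_def t_def)
      also have "\<dots> = l j * (1 - p * t) * (y j m + r * Z j m)
          + l j * Z j m * (of_real (t - r) + p * (r * t)) + (\<rho> j + t * S)"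
        unfolding yS ZS by (simp add: algebra_simps)
      also have "of_real (t - r) + p * (r * t) = complex_of_real ((p - 1) * (r * t))"
        by (simp only: t(5) of_real_mult of_real_minus of_real_diff) (simp add: algebra_simps)
      also have "y j m + r * Z j m = Y j m"
        by (simp add: Y_def r_def)
      finally have eq: "Y j (Suc m) = l j * (1 - p * t) * Y j m
          + l j * Z j m * complex_of_real ((p - 1) * (r * t)) + (\<rho> j + t * S)" .
      have pt: "0 \<le> 1 - p * t"
      proof -
        have "p * t \<le> p * r" using t p by (intro mult_left_mono) auto
        also have "p * r \<le> 1" using big(4)[OF m] by (simp add: r_def)
        finally show ?thesis by simp
      qed
      have n1: "cmod (l j * (1 - p * t) * Y j m) = (1 - p * t) * cmod (Y j m)"
      proof -
        have "cmod (1 - p * t) = 1 - p * t"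
          using pt norm_of_real[of "1 - p * t", where 'a = complex] by simp
        then show ?thesis using l[OF j] by (simp add: norm_mult)
      qed
      have n2: "cmod (l j * Z j m * complex_of_real ((p - 1) * (r * t))) \<le> \<eta> * t * s m"
      proof -
        have "cmod (l j * Z j m * complex_of_real ((p - 1) * (r * t))) = cmod (Z j m) * (\<bar>p - 1\<bar> * (r * t))"
          unfolding norm_mult norm_of_real abs_mult using l[OF j] t by simp
        also have "\<dots> \<le> (\<tau> * s m) * (\<bar>p - 1\<bar> * (r * t))"
          using Zle[OF j] t by (intro mult_right_mono) auto
        also have "\<dots> = (\<tau> * \<bar>p - 1\<bar> * r) * (t * s m)" by simp
        also have "\<dots> \<le> \<eta> * (t * s m)"
          using big(2)[OF m] t s by (intro mult_right_mono) (auto simp: r_def)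
        finally show ?thesis by simp
      qed
      define b where "b = g (Suc m) + \<eta> * t * s m + p * t * s m"
      have "cmod S \<le> (\<Sum>i\<in>I. cmod (T j i) * b)"
        unfolding S_def
      proof (rule order_trans[OF norm_sum], rule sum_mono)
        fix i assume i: "i \<in> I"
        have "cmod (p * t * L) \<le> p * t * s m"
          using Lle p t by (simp add: norm_mult)
        then have "cmod (\<rho> i - p * t * L) \<le> b"
          using \<rho>[OF i] norm_triangle_ineq4[of "\<rho> i" "p * t * L"] by (simp add: b_def)
        then show "cmod (T j i * (\<rho> i - p * t * L)) \<le> cmod (T j i) * b"
          unfolding norm_mult by (rule mult_left_mono) simp
      qed
      also have "\<dots> \<le> \<tau> * b"
        unfolding sum_distrib_right[symmetric] b_def
        using Tbound[OF j] g s \<eta> p t by (intro mult_right_mono) auto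
      finally have "cmod (t * S) \<le> t * (\<tau> * b)"
        using t by (simp add: norm_mult)
      also have "\<dots> = (t * \<tau>) * (g (Suc m) + \<eta> * t * s m) + (p * \<tau> * t) * (t * s m)"
        by (simp add: b_def algebra_simps)
      also have "\<dots> \<le> 1 * (g (Suc m) + \<eta> * t * s m) + \<eta> * (t * s m)"
      proof (intro add_mono mult_right_mono)
        have "\<tau> * t \<le> \<tau> * r" "p * \<tau> * t \<le> p * \<tau> * r"
          using t \<tau> p by (auto intro!: mult_left_mono)
        moreover have "\<tau> * r \<le> 1/2" "p * \<tau> * r \<le> \<eta>"
          using big(1,3)[OF m] by (simp_all add: r_def)
        ultimately show "t * \<tau> \<le> 1" "p * \<tau> * t \<le> \<eta>"
          unfolding mult.commute[of t \<tau>] by linarith+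
      qed (use g s \<eta> t in auto)
      finally have n3: "cmod (\<rho> j + t * S) \<le> 2 * g (Suc m) + 3 * \<eta> * t * s m"
        using \<rho>[OF j] norm_triangle_ineq[of "\<rho> j" "t * S"] by simp
      have "cmod (Y j (Suc m)) \<le> (1 - p * t) * cmod (Y j m) + \<eta> * t * s m
          + (2 * g (Suc m) + 3 * \<eta> * t * s m)"
        unfolding eq using n1 n2 n3 norm_triangle_ineq by (smt (verit))
      then show ?thesis by (simp add: t_def)
    qed
    have Ustep: "U (Suc m) \<le> (1 - q / Suc m) * U m + 2 * n * g (Suc m)" if m: "m \<ge> N" for m
    proof -
      define t where "t = 1 / real (Suc m)"
      have t: "t > 0" by (simp add: t_def)
      have "U (Suc m) \<le> (\<Sum>j\<in>I. (1 - p * t) * cmod (Y j m) + 2 * g (Suc m) + 4 * \<eta> * t * s m)"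
        unfolding U_def using Ystep[OF m] by (intro sum_mono) (simp add: t_def)
      also have "\<dots> = (1 - p * t) * U m + 2 * n * g (Suc m) + 4 * n * \<eta> * t * s m"
        by (simp add: U_def sum.distrib sum_distrib_left n_def)
      also have "4 * n * \<eta> * t * s m \<le> 4 * n * \<eta> * t * (2 * U m)"
        using Ys(2)[OF m] n \<eta> t by (intro mult_left_mono) auto
      also have "\<dots> = (8 * n * \<eta>) * (t * U m)" by simp
      also have "\<dots> \<le> (p - q) * (t * U m)"
        using n\<eta> t U by (intro mult_right_mono) auto
      finally have "U (Suc m) \<le> (1 - q * t) * U m + 2 * n * g (Suc m)"
        by (simp add: algebra_simps)
      then show ?thesis by (simp add: t_def)
    qed
    define G where "G = (\<lambda>m. 2 * n * g m)"
    let ?A = "\<Sum>m=N..<M. (Suc m * g (Suc m))\<^sup>2"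
    have A: "?A \<ge> 0" by (intro sum_nonneg) auto
    have "d / 4 * (\<Sum>m=N..<M. (U m)\<^sup>2)
      \<le> real N * (U N)\<^sup>2 + (1 + 4 / d) * (\<Sum>m=N..<M. (real (Suc m) * G (Suc m))\<^sup>2)"
      unfolding d_def using big(6,7)[of N] U g n q Ustep
      by (intro discrete_hardy) (auto simp: G_def)
    also have "(\<Sum>m=N..<M. (real (Suc m) * G (Suc m))\<^sup>2) = (2 * n)\<^sup>2 * ?A"
      unfolding sum_distrib_left by (intro sum.cong) (auto simp: G_def power_mult_distrib)
    also have "real N * (U N)\<^sup>2 \<le> real N * (2 * s N)\<^sup>2"
      using Ys(1)[of N] U by (intro mult_left_mono power_mono) auto
    finally have 1: "d / 4 * (\<Sum>m=N..<M. (U m)\<^sup>2)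
        \<le> 4 * (N * (s N)\<^sup>2) + (1 + 4 / d) * (2 * n)\<^sup>2 * ?A"
      by simp
    also have "\<dots> \<le> (4 + (1 + 4 / d) * (2 * n)\<^sup>2) * (N * (s N)\<^sup>2 + ?A)"
      using A d n by (simp add: algebra_simps add_increasing)
    finally have 2: "(\<Sum>m=N..<M. (U m)\<^sup>2) \<le> 4 / d * (4 + (1 + 4 / d) * (2 * n)\<^sup>2) * (N * (s N)\<^sup>2 + ?A)"
      using d by (simp add: field_simps)
    have "(\<Sum>m=N..<M. (s m)\<^sup>2) \<le> (\<Sum>m=N..<M. 4 * (U m)\<^sup>2)"
    proof (rule sum_mono)
      fix m assume "m \<in> {N..<M}"
      then have "(s m)\<^sup>2 \<le> (2 * U m)\<^sup>2" using Ys(2)[of m] s by (intro power_mono) auto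
      then show "(s m)\<^sup>2 \<le> 4 * (U m)\<^sup>2" by simp
    qed
    also have "\<dots> = (\<Sum>m=N..<M. (U m)\<^sup>2) * 4"
      by (simp add: sum_distrib_left mult.commute)
    also have "\<dots> \<le> (4 / d * (4 + (1 + 4 / d) * (2 * n)\<^sup>2) * (N * (s N)\<^sup>2 + ?A)) * 4"
      using 2 by (rule mult_right_mono) simp
    also have "\<dots> = C * (N * (s N)\<^sup>2 + ?A)"
      by (simp only: C_def mult_ac)
    finally show "(\<Sum>m=N..<M. (\<Sum>i\<in>I. cmod (y i m))\<^sup>2)
        \<le> C * (N * (\<Sum>i\<in>I. cmod (y i N))\<^sup>2 + ?A)"
      by (simp only: s_def)
  qed (use \<eta> in auto)
qed

section \<open>Polynomials in the shift and the modes of a recurrence\<close>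

text \<open>
  The operator \<open>P(S)\<close>, where \<open>S\<close> moves a sequence by one place and fills in zero. On generating
  functions it is multiplication by \<open>P\<close>, so \<open>P \<mapsto> P(S)\<close> is multiplicative.
\<close>

definition shift_poly :: "complex poly \<Rightarrow> (nat \<Rightarrow> complex) \<Rightarrow> nat \<Rightarrow> complex" where
  "shift_poly P b m = (\<Sum>k\<le>m. coeff P k * b (m - k))"

definition lin_prod :: "('i \<Rightarrow> complex) \<Rightarrow> 'i set \<Rightarrow> complex poly" where
  "lin_prod l I = (\<Prod>i\<in>I. [:1, - l i:])"

lemma shift_poly_fps: "shift_poly P b m = fps_nth (fps_of_poly P * Abs_fps b) m"
  by (simp add: shift_poly_def fps_mult_nth atLeast0AtMost)

lemma shift_poly_linear_factor:
  "shift_poly ([:1, - c:] * Q) b (Suc m) = shift_poly Q b (Suc m) - c * shift_poly Q b m"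
proof -
  have "fps_of_poly ([:1, - c:] * Q) * Abs_fps b
      = fps_of_poly Q * Abs_fps b - fps_const c * (fps_X * (fps_of_poly Q * Abs_fps b))"
    unfolding fps_of_poly_mult fps_of_poly_linear' by (simp add: algebra_simps flip: fps_const_neg)
  then show ?thesis
    unfolding shift_poly_fps by simp
qed

lemma shift_poly_sum:
  "shift_poly (\<Sum>i\<in>A. smult (d i) (P i)) b m = (\<Sum>i\<in>A. d i * shift_poly (P i) b m)"
  unfolding shift_poly_def coeff_sum sum_distrib_left sum_distrib_right
  by (subst sum.swap) (simp add: mult_ac)

lemma shift_poly_monom: "k \<le> m \<Longrightarrow> shift_poly (monom 1 k) b m = b (m - k)"
  unfolding shift_poly_def coeff_monom by (simp add: if_distrib[of "\<lambda>c. c * _"] cong: if_cong)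

lemma shift_poly_Suc:
  "shift_poly P b (Suc m) = coeff P 0 * b (Suc m) + (\<Sum>i\<le>m. coeff P (Suc i) * b (m - i))"
  unfolding shift_poly_def by (subst sum.atMost_Suc_shift) simp

lemma shift_poly_pderiv:
  "shift_poly (pderiv P) b m = (\<Sum>i\<le>m. of_nat (Suc i) * coeff P (Suc i) * b (m - i))"
  by (simp add: shift_poly_def coeff_pderiv)

lemma poly_lin_prod: "poly (lin_prod l I) x = (\<Prod>i\<in>I. 1 - l i * x)"
  by (simp add: lin_prod_def poly_prod mult.commute)

lemma coeff_0_lin_prod: "coeff (lin_prod l I) 0 = 1"
  by (simp add: poly_lin_prod flip: poly_0_coeff_0)

lemma degree_lin_prod: "finite I \<Longrightarrow> degree (lin_prod l I) \<le> card I"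
proof -
  assume I: "finite I"
  have "degree (lin_prod l I) \<le> (\<Sum>i\<in>I. degree [:1, - l i:])"
    unfolding lin_prod_def using degree_prod_sum_le[OF I, of "\<lambda>i. [:1, - l i:]"] by (simp add: o_def)
  also have "\<dots> \<le> (\<Sum>i\<in>I. 1)"
    by (intro sum_mono) simp
  finally show ?thesis by simp
qed

lemma lin_prod_remove: "finite I \<Longrightarrow> j \<in> I \<Longrightarrow> lin_prod l I = [:1, - l j:] * lin_prod l (I - {j})"
  unfolding lin_prod_def by (rule prod.remove)

lemma pderiv_lin_prod: "pderiv (lin_prod l I) = (\<Sum>i\<in>I. smult (- l i) (lin_prod l (I - {i})))"
  unfolding lin_prod_def pderiv_prod by (intro sum.cong) (auto simp: pderiv_pCons)

text \<open>
  Lagrange interpolation at the points \<open>1 / l\<^sub>i\<close>: each cofactor vanishes at all of them but one.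
  Applied to \<open>S\<close>, this recovers the last \<open>card I\<close> values of a sequence from its modes.
\<close>

lemma monom_in_span_cofactors:
  assumes I: "finite I" and inj: "inj_on l I" and nz: "\<And>i. i \<in> I \<Longrightarrow> l i \<noteq> 0" and k: "k < card I"
  obtains d where "monom 1 k = (\<Sum>i\<in>I. smult (d i) (lin_prod l (I - {i})))"
proof -
  define d where "d = (\<lambda>i. (1 / l i) ^ k / poly (lin_prod l (I - {i})) (1 / l i))"
  have "monom 1 k = (\<Sum>i\<in>I. smult (d i) (lin_prod l (I - {i})))"
  proof (rule poly_eqI_degree)
    fix x assume "x \<in> (\<lambda>i. 1 / l i) ` I"
    then obtain j where j: "j \<in> I" "x = 1 / l j" by blast
    have nz0: "poly (lin_prod l (I - {j})) x \<noteq> 0"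
      using I j nz[of j] inj by (auto simp: poly_lin_prod dest: inj_onD)
    have "poly (lin_prod l (I - {i})) x = 0" if "i \<in> I" "i \<noteq> j" for i
      using I j that nz[of j] by (auto simp: poly_lin_prod)
    then have "(\<Sum>i\<in>I. d i * poly (lin_prod l (I - {i})) x)
        = (\<Sum>i\<in>I. if i = j then d j * poly (lin_prod l (I - {j})) x else 0)"
      by (intro sum.cong) auto
    also have "\<dots> = x ^ k"
      using I j nz0 by (simp add: d_def)
    finally show "poly (monom 1 k) x = poly (\<Sum>i\<in>I. smult (d i) (lin_prod l (I - {i}))) x"
      by (simp add: poly_sum poly_monom)
  next
    have "inj_on (\<lambda>i. 1 / l i) I"
      using inj by (auto simp: inj_on_def)
    then have c: "card ((\<lambda>i. 1 / l i) ` I) = card I"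
      by (rule card_image)
    then show "card ((\<lambda>i. 1 / l i) ` I) > degree (monom 1 k :: complex poly)"
      using k by (simp add: degree_monom_eq)
    have "degree (smult (d i) (lin_prod l (I - {i}))) \<le> card I - 1" if "i \<in> I" for i
      using degree_lin_prod[of "I - {i}" l] I that degree_smult_le le_trans by fastforce
    then have "degree (\<Sum>i\<in>I. smult (d i) (lin_prod l (I - {i}))) \<le> card I - 1"
      using I by (intro degree_sum_le) auto
    then show "card ((\<lambda>i. 1 / l i) ` I) > degree (\<Sum>i\<in>I. smult (d i) (lin_prod l (I - {i})))"
      unfolding c using k by linarith
  qed
  then show ?thesis using that by blast
qed

section \<open>The triangular recurrence\<close>

text \<open>
  Forward substitution; \<open>A i n\<close> is the weight of the entry \<open>n\<close> in the equation \<open>n + i + 1\<close>.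
\<close>

fun triangular_solution :: "(nat \<Rightarrow> nat \<Rightarrow> complex) \<Rightarrow> (nat \<Rightarrow> complex) \<Rightarrow> nat \<Rightarrow> complex" where
  "triangular_solution A h m =
    h m - (\<Sum>i<m. A i (m - Suc i) * triangular_solution A h (m - Suc i))"

declare triangular_solution.simps [simp del]

text \<open>
  The constant grows with \<open>m\<close> without control. The bound serves only for the finitely many indices
  before the asymptotic regime.
\<close>

lemma triangular_solution_bound:
  "\<exists>K\<ge>0. \<forall>h H. (\<forall>n. cmod (h n) \<le> H) \<longrightarrow> cmod (triangular_solution A h m) \<le> K * H"
proof (induction m rule: less_induct)
  case (less m)
  then obtain K where K: "\<And>n. n < m \<Longrightarrow> K n \<ge> 0 \<and>
      (\<forall>h H. (\<forall>n. cmod (h n) \<le> H) \<longrightarrow> cmod (triangular_solution A h n) \<le> K n * H)"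
    by metis
  have "cmod (triangular_solution A h m) \<le> (1 + (\<Sum>i<m. cmod (A i (m - Suc i)) * K (m - Suc i))) * H"
    if H: "\<forall>n. cmod (h n) \<le> H" for h H
  proof -
    have "cmod (triangular_solution A h m)
        \<le> cmod (h m) + (\<Sum>i<m. cmod (A i (m - Suc i) * triangular_solution A h (m - Suc i)))"
      unfolding triangular_solution.simps[of A h m]
      by (rule order_trans[OF norm_triangle_ineq4]) (intro add_left_mono norm_sum)
    also have "\<dots> \<le> H + (\<Sum>i<m. cmod (A i (m - Suc i)) * (K (m - Suc i) * H))"
      unfolding norm_mult using H K by (intro add_mono sum_mono mult_left_mono) auto
    finally show ?thesis by (simp add: algebra_simps sum_distrib_left)
  qed
  moreover have "1 + (\<Sum>i<m. cmod (A i (m - Suc i)) * K (m - Suc i)) \<ge> 0"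
    using K by (intro add_nonneg_nonneg sum_nonneg mult_nonneg_nonneg) auto
  ultimately show ?case by blast
qed

lemma dilation_tendsto_1:
  assumes "(\<lambda>n. of_nat n * (1 - a n)) \<longlonglongrightarrow> complex_of_real p"
  shows "a \<longlonglongrightarrow> 1"
proof -
  have "(\<lambda>n. 1 - (1 / of_nat n) * (of_nat n * (1 - a n))) \<longlonglongrightarrow> 1 - 0 * complex_of_real p"
    by (intro tendsto_intros assms lim_1_over_n)
  moreover have "\<forall>\<^sub>F n in sequentially. 1 - (1 / of_nat n) * (of_nat n * (1 - a n)) = a n"
    using eventually_gt_at_top[of 0] by eventually_elim simp
  ultimately show ?thesis
    by (auto dest: Lim_transform_eventually)
qed

text \<open>
  Since \<open>1 - a\<^sup>k = (1 - a) (1 + a + \<dots> + a\<^sup>k\<^sup>-\<^sup>1)\<close> and the second factor tends to \<open>k\<close>. Delaying the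
  index by a fixed \<open>i\<close> changes the weight by a bounded amount only.
\<close>

lemma dilation_power_limit:
  assumes a: "(\<lambda>n. of_nat n * (1 - a n)) \<longlonglongrightarrow> complex_of_real p"
  shows "(\<lambda>m. of_nat (Suc m) * (1 - a (m - i) ^ k)) \<longlonglongrightarrow> of_nat k * complex_of_real p"
proof (rule LIMSEQ_offset[of _ i])
  note a1 = dilation_tendsto_1[OF a]
  have "(\<lambda>m. (of_nat m * (1 - a m)) * (\<Sum>j<k. a m ^ j) + of_nat (Suc i) * (1 - a m ^ k))
      \<longlonglongrightarrow> complex_of_real p * (\<Sum>j<k. 1 ^ j) + of_nat (Suc i) * (1 - 1 ^ k)"
    by (intro tendsto_intros a a1)
  moreover have "(of_nat m * (1 - a m)) * (\<Sum>j<k. a m ^ j) + of_nat (Suc i) * (1 - a m ^ k)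
      = of_nat (Suc (m + i)) * (1 - a (m + i - i) ^ k)" for m
    by (simp add: one_diff_power_eq algebra_simps del: of_nat_Suc) (simp add: algebra_simps)
  ultimately show "(\<lambda>m. of_nat (Suc (m + i)) * (1 - a (m + i - i) ^ k)) \<longlonglongrightarrow> of_nat k * complex_of_real p"
    by (simp add: mult.commute)
qed

text \<open>
  Both powers differ from \<open>1\<close> by a multiple of \<open>1/m\<close> up to \<open>o(1/m)\<close>. For
  \<open>i > 0\<close> both indices lag behind \<open>m\<close> by a fixed amount, and for \<open>i = 0\<close> the powers are equal.
\<close>

lemma dilation_power_difference_bound:
  assumes a: "(\<lambda>n. of_nat n * (1 - a n)) \<longlonglongrightarrow> complex_of_real p"
  shows "\<exists>B\<ge>0. \<forall>m\<ge>i. real (Suc m) * cmod (a (m - i) ^ i - a (Suc m - i) ^ i) \<le> B"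
proof (cases i)
  case (Suc r)
  have "(\<lambda>m. of_nat (Suc m) * (1 - a (m - r) ^ i) - of_nat (Suc m) * (1 - a (m - i) ^ i))
      \<longlonglongrightarrow> of_nat i * complex_of_real p - of_nat i * complex_of_real p"
    by (intro tendsto_diff dilation_power_limit a)
  then have "Bseq (\<lambda>m. of_nat (Suc m) * (1 - a (m - r) ^ i) - of_nat (Suc m) * (1 - a (m - i) ^ i))"
    using convergentI convergent_imp_Bseq by blast
  then obtain B where B: "B > 0" and
    "\<And>m. cmod (of_nat (Suc m) * (1 - a (m - r) ^ i) - of_nat (Suc m) * (1 - a (m - i) ^ i)) \<le> B"
    by (auto simp: Bseq_def)
  moreover have "of_nat (Suc m) * (1 - a (m - r) ^ i) - of_nat (Suc m) * (1 - a (m - i) ^ i)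
      = of_nat (Suc m) * (a (m - i) ^ i - a (Suc m - i) ^ i)" for m
    by (simp add: Suc algebra_simps)
  ultimately have "\<And>m. real (Suc m) * cmod (a (m - i) ^ i - a (Suc m - i) ^ i) \<le> B"
    by (metis norm_mult norm_of_nat)
  with B show ?thesis by (intro exI[of _ B]) auto
qed (auto intro: exI[of _ 0])

lemma sum_atMost_le_of_support:
  fixes u :: "nat \<Rightarrow> real"
  assumes "\<And>i. u i \<ge> 0" and "\<And>i. i > n \<Longrightarrow> u i = 0"
  shows "(\<Sum>i\<le>m. u i) \<le> (\<Sum>i\<le>n. u i)"
proof -
  have "(\<Sum>i\<le>m. u i) = (\<Sum>i\<in>{..m} \<inter> {..n}. u i)"
    using assms(2) by (intro sum.mono_neutral_right) (auto, metis not_le)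
  also have "\<dots> \<le> (\<Sum>i\<le>n. u i)"
    using assms(1) by (intro sum_mono2) auto
  finally show ?thesis .
qed

text \<open>
  Young's inequality for the convolution of a summable with a square summable sequence, in a form for
  partial sums.
\<close>

lemma young_l1_l2:
  fixes u x :: "nat \<Rightarrow> real"
  assumes u: "\<And>i. u i \<ge> 0" and W: "\<And>m. (\<Sum>i\<le>m. u i) \<le> W"
  shows "(\<Sum>m<M. (\<Sum>i\<le>m. u i * x (m - i))\<^sup>2) \<le> W\<^sup>2 * (\<Sum>m<M. (x m)\<^sup>2)"
proof -
  have W0: "W \<ge> 0"
    using u[of 0] W[of 0] by simp
  have "(\<Sum>i\<le>m. u i * x (m - i))\<^sup>2 \<le> W * (\<Sum>i\<le>m. u i * (x (m - i))\<^sup>2)" for m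
  proof -
    have "(\<Sum>i\<le>m. u i * x (m - i))\<^sup>2 = (\<Sum>i\<le>m. sqrt (u i) * (sqrt (u i) * x (m - i)))\<^sup>2"
      using u by (simp flip: mult.assoc)
    also have "\<dots> \<le> (\<Sum>i\<le>m. (sqrt (u i))\<^sup>2) * (\<Sum>i\<le>m. (sqrt (u i) * x (m - i))\<^sup>2)"
      by (rule Cauchy_Schwarz_ineq_sum)
    also have "\<dots> = (\<Sum>i\<le>m. u i) * (\<Sum>i\<le>m. u i * (x (m - i))\<^sup>2)"
      using u by (simp add: power_mult_distrib)
    also have "\<dots> \<le> W * (\<Sum>i\<le>m. u i * (x (m - i))\<^sup>2)"
      using W u by (intro mult_right_mono sum_nonneg) auto
    finally show ?thesis .
  qed
  then have "(\<Sum>m<M. (\<Sum>i\<le>m. u i * x (m - i))\<^sup>2) \<le> (\<Sum>m<M. W * (\<Sum>i\<le>m. u i * (x (m - i))\<^sup>2))"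
    by (intro sum_mono)
  also have "\<dots> = W * (\<Sum>m<M. \<Sum>i\<le>m. u i * (x (m - i))\<^sup>2)"
    by (simp add: sum_distrib_left)
  also have "(\<Sum>m<M. \<Sum>i\<le>m. u i * (x (m - i))\<^sup>2) = (\<Sum>(i,j)\<in>{(i,j). i + j < M}. u i * (x j)\<^sup>2)"
    by (rule sum.triangle_reindex[symmetric])
  also have "\<dots> \<le> (\<Sum>(i,j)\<in>{..<M} \<times> {..<M}. u i * (x j)\<^sup>2)"
    using u by (intro sum_mono2) auto
  also have "\<dots> = (\<Sum>i<M. u i) * (\<Sum>j<M. (x j)\<^sup>2)"
    by (simp add: sum_product sum.cartesian_product)
  also have "(\<Sum>i<M. u i) \<le> W"
    using W u by (cases M) (use W0 in \<open>auto simp: lessThan_Suc_atMost\<close>)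
  finally show ?thesis
    using W0 by (simp add: power2_eq_square mult_left_mono mult_right_mono sum_nonneg)
qed

text \<open>
  The modes \<open>y\<^sub>j = Q\<^sub>j(S) b\<close> of the solution satisfy the hypothesis of
  \<open>perturbed_rotation_l2_bound\<close>. Indeed \<open>y\<^sub>j(m+1) - l\<^sub>j y\<^sub>j(m)\<close> is \<open>P(S) b\<close> at \<open>m + 1\<close>;
  subtracting the recurrence replaces each coefficient \<open>c\<^sub>k\<close> with \<open>c\<^sub>k (1 - a\<^sup>k)\<close>, which is
  \<open>k c\<^sub>k p/(m+1)\<close> up to \<open>o(1/m)\<close>, and the weights \<open>k c\<^sub>k\<close> belong to the derivative of \<open>P\<close>,
  which is minus the sum of the \<open>l\<^sub>i Q\<^sub>i\<close>. The constant is uniform in the right-hand side \<open>h\<close>;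
  this uniformity is what makes the resulting operator bounded.
\<close>

lemma recurrence_l2_bound:
  fixes l :: "'i \<Rightarrow> complex" and a :: "nat \<Rightarrow> complex" and p :: real
  assumes I: "finite I" "I \<noteq> {}" and inj: "inj_on l I" and unit: "\<forall>i\<in>I. cmod (l i) = 1"
    and p: "p > 1/2" and a: "(\<lambda>n. of_nat n * (1 - a n)) \<longlonglongrightarrow> complex_of_real p"
  defines "A \<equiv> \<lambda>i n. coeff (lin_prod l I) (Suc i) * a n ^ Suc i"
  shows "\<exists>C\<ge>0. \<forall>h S M. h 0 = 0 \<longrightarrow> (\<forall>M. (\<Sum>m<M. (real (Suc m) * cmod (h (Suc m)))\<^sup>2) \<le> S) \<longrightarrow>
      (\<Sum>m<M. (cmod (triangular_solution A h m))\<^sup>2) \<le> C * S"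
proof -
  define n where "n = card I"
  define P where "P = lin_prod l I"
  define Q where "Q = (\<lambda>j. lin_prod l (I - {j}))"
  have n: "n > 0" using I by (simp add: n_def card_gt_0_iff)
  have degP: "coeff P i = 0" if "i > n" for i
    using degree_lin_prod[OF I(1), of l] that by (intro coeff_eq_0) (simp add: P_def n_def)
  have l0: "l i \<noteq> 0" if "i \<in> I" for i
    using unit that by force
  have "\<exists>d. monom 1 k = (\<Sum>i\<in>I. smult (d i) (Q i))" if "k < n" for k
    using monom_in_span_cofactors[OF I(1) inj l0] that unfolding n_def Q_def by metis
  then obtain d where d: "\<And>k. k < n \<Longrightarrow> monom 1 k = (\<Sum>i\<in>I. smult (d k i) (Q i))"
    by metis
  define D where "D = (\<Sum>k<n. \<Sum>i\<in>I. cmod (d k i))"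
  have D: "D \<ge> 0" unfolding D_def by (intro sum_nonneg) auto
  have recover: "cmod (b (m - k)) \<le> D * (\<Sum>i\<in>I. cmod (shift_poly (Q i) b m))"
    if "k < n" "k \<le> m" for b m k
  proof -
    have dD: "cmod (d k i) \<le> D" if "i \<in> I" for i
    proof -
      have "cmod (d k i) \<le> (\<Sum>i\<in>I. cmod (d k i))"
        using I that by (intro member_le_sum) auto
      also have "\<dots> \<le> D"
        unfolding D_def using \<open>k < n\<close>
        by (intro member_le_sum[of k _ "\<lambda>k. \<Sum>i\<in>I. cmod (d k i)"]) (auto intro: sum_nonneg)
      finally show ?thesis .
    qed
    have "b (m - k) = (\<Sum>i\<in>I. d k i * shift_poly (Q i) b m)"
      using shift_poly_monom[OF that(2), of b] d[OF that(1)] shift_poly_sum[of "d k" Q I b m] by simp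
    also have "cmod \<dots> \<le> (\<Sum>i\<in>I. D * cmod (shift_poly (Q i) b m))"
      by (rule order_trans[OF norm_sum]) (auto simp: norm_mult intro!: sum_mono mult_right_mono dD)
    finally show ?thesis by (simp add: sum_distrib_left)
  qed
  obtain \<eta> N\<^sub>0 C\<^sub>1 where \<eta>: "\<eta> > 0" and C1: "C\<^sub>1 \<ge> 0" and rot:
    "\<forall>N\<ge>N\<^sub>0. \<forall>M y. \<forall>g :: nat \<Rightarrow> real. (\<forall>m. g m \<ge> 0) \<longrightarrow>
      (\<forall>m\<ge>N. \<forall>j\<in>I. cmod (y j (Suc m) - l j * y j m + p / Suc m * (\<Sum>i\<in>I. l i * y i m))
          \<le> g (Suc m) + \<eta> / Suc m * (\<Sum>i\<in>I. cmod (y i m))) \<longrightarrow>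
      (\<Sum>m=N..<M. (\<Sum>i\<in>I. cmod (y i m))\<^sup>2)
        \<le> C\<^sub>1 * (N * (\<Sum>i\<in>I. cmod (y i N))\<^sup>2 + (\<Sum>m=N..<M. (Suc m * g (Suc m))\<^sup>2))"
    using perturbed_rotation_l2_bound[OF I(1) inj unit p] by (elim exE conjE) (rule that)
  define W where "W = (\<Sum>i\<le>n. cmod (coeff P (Suc i)))"
  have W: "(\<Sum>i\<le>m. cmod (coeff P (Suc i))) \<le> W" for m
    unfolding W_def by (rule sum_atMost_le_of_support) (auto intro: degP)
  have W0: "W \<ge> 0" unfolding W_def by (intro sum_nonneg) auto
  \<comment> \<open>Small enough for the \<open>o(1/m)\<close> errors in all coefficients to fit into the tolerance
    \<open>\<eta>\<close>; the summand \<open>1\<close> only avoids a division by zero.\<close>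
  define \<epsilon> where "\<epsilon> = \<eta> / (W * D + 1)"
  have \<epsilon>: "\<epsilon> > 0" "W * \<epsilon> * D \<le> \<eta>"
  proof -
    have WD: "W * D \<ge> 0" using W0 D by simp
    then show "\<epsilon> > 0" using \<eta> by (simp add: \<epsilon>_def)
    have "W * D * \<eta> \<le> \<eta> * (W * D + 1)" using \<eta> by (simp add: algebra_simps)
    then show "W * \<epsilon> * D \<le> \<eta>" using WD by (simp add: \<epsilon>_def divide_le_eq mult_ac)
  qed
  have "\<forall>\<^sub>F m in sequentially. \<forall>i\<in>{..<n}.
      cmod (of_nat (Suc m) * (1 - a (m - i) ^ Suc i) - of_nat (Suc i) * complex_of_real p) < \<epsilon>"
    using tendstoD[OF dilation_power_limit[OF a] \<epsilon>(1)]
    by (intro eventually_ball_finite) (auto simp only: dist_norm finite_lessThan)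
  then obtain N\<^sub>1 where N1: "\<And>m i. m \<ge> N\<^sub>1 \<Longrightarrow> i < n \<Longrightarrow>
      cmod (of_nat (Suc m) * (1 - a (m - i) ^ Suc i) - of_nat (Suc i) * complex_of_real p) < \<epsilon>"
    by (auto simp: eventually_sequentially)
  define N where "N = max N\<^sub>0 N\<^sub>1"
  obtain K where K: "\<And>m. K m \<ge> 0"
    "\<And>m h H. (\<forall>n. cmod (h n) \<le> H) \<Longrightarrow> cmod (triangular_solution A h m) \<le> K m * H"
    using triangular_solution_bound[of A] by metis
  define E where "E = (\<Sum>j\<in>I. \<Sum>k\<le>N. cmod (coeff (Q j) k) * K (N - k))"
  have E: "E \<ge> 0" unfolding E_def using K by (intro sum_nonneg mult_nonneg_nonneg) auto
  define C where "C = (\<Sum>m<N. (K m)\<^sup>2) + D\<^sup>2 * (C\<^sub>1 * (N * E\<^sup>2 + 1))"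
  show ?thesis
  proof (intro exI[of _ C] conjI allI impI)
    show "C \<ge> 0" unfolding C_def using C1 by (intro add_nonneg_nonneg sum_nonneg mult_nonneg_nonneg) auto
    fix h :: "nat \<Rightarrow> complex" and S :: real and M :: nat
    assume h0: "h 0 = 0" and "\<forall>M. (\<Sum>m<M. (real (Suc m) * cmod (h (Suc m)))\<^sup>2) \<le> S"
    then have S: "(\<Sum>m<M. (real (Suc m) * cmod (h (Suc m)))\<^sup>2) \<le> S" for M by blast
    have S0: "S \<ge> 0" using S[of 0] by simp
    define b where "b = triangular_solution A h"
    define y where "y = (\<lambda>j. shift_poly (Q j) b)"
    have hS: "cmod (h m) \<le> sqrt S" for m
    proof (cases m)
      case (Suc k)
      have "cmod (h (Suc k)) \<le> real (Suc k) * cmod (h (Suc k))"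
        using mult_right_mono[of 1 "real (Suc k)" "cmod (h (Suc k))"] by simp
      then have "(cmod (h (Suc k)))\<^sup>2 \<le> (real (Suc k) * cmod (h (Suc k)))\<^sup>2"
        by (intro power_mono) auto
      also have "\<dots> \<le> (\<Sum>m<Suc k. (real (Suc m) * cmod (h (Suc m)))\<^sup>2)"
        by (rule member_le_sum) auto
      also have "\<dots> \<le> S" by (rule S)
      finally show ?thesis using Suc by (simp add: real_le_rsqrt)
    qed (use h0 S0 in simp)
    have bK: "cmod (b m) \<le> K m * sqrt S" for m
      unfolding b_def using K(2) hS by blast
    have bSuc: "b (Suc m) = h (Suc m) - (\<Sum>i\<le>m. coeff P (Suc i) * a (m - i) ^ Suc i * b (m - i))" for m
      unfolding b_def by (subst triangular_solution.simps)
        (simp add: A_def P_def lessThan_Suc_atMost)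
    have step: "cmod (y j (Suc m) - l j * y j m + p / Suc m * (\<Sum>i\<in>I. l i * y i m))
          \<le> cmod (h (Suc m)) + \<eta> / Suc m * (\<Sum>i\<in>I. cmod (y i m))" if m: "m \<ge> N" and j: "j \<in> I" for m j
    proof -
      define s where "s = (\<Sum>i\<in>I. cmod (y i m))"
      have s: "s \<ge> 0" unfolding s_def by (intro sum_nonneg) auto
      \<comment> \<open>The deviation of a coefficient from its first-order expansion in \<open>1/m\<close>.\<close>
      define e where "e = (\<lambda>i. 1 - a (m - i) ^ Suc i - of_nat (Suc i) * complex_of_real (p / Suc m))"
      have "y j (Suc m) - l j * y j m = shift_poly P b (Suc m)"
        unfolding y_def P_def lin_prod_remove[OF I(1) j] shift_poly_linear_factor Q_def ..
      also have "\<dots> = h (Suc m) + (\<Sum>i\<le>m. coeff P (Suc i) * (1 - a (m - i) ^ Suc i) * b (m - i))"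
        unfolding shift_poly_Suc bSuc
        by (simp add: P_def coeff_0_lin_prod algebra_simps sum_subtractf)
      finally have 1: "y j (Suc m) - l j * y j m = \<dots>" .
      have "(\<Sum>i\<in>I. l i * y i m) = - shift_poly (pderiv P) b m"
        unfolding P_def pderiv_lin_prod shift_poly_sum y_def Q_def by (simp add: sum_negf)
      then have 2: "(\<Sum>i\<in>I. l i * y i m) = - (\<Sum>i\<le>m. of_nat (Suc i) * coeff P (Suc i) * b (m - i))"
        unfolding shift_poly_pderiv .
      have eq: "y j (Suc m) - l j * y j m + p / Suc m * (\<Sum>i\<in>I. l i * y i m)
          = h (Suc m) + (\<Sum>i\<le>m. coeff P (Suc i) * e i * b (m - i))"
      proof -
        define r where "r = complex_of_real (p / Suc m)"
        have "(\<Sum>i\<le>m. coeff P (Suc i) * e i * b (m - i))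
            = (\<Sum>i\<le>m. coeff P (Suc i) * (1 - a (m - i) ^ Suc i) * b (m - i))
              - r * (\<Sum>i\<le>m. of_nat (Suc i) * coeff P (Suc i) * b (m - i))"
          unfolding sum_distrib_left sum_subtractf[symmetric] e_def r_def[symmetric]
          by (intro sum.cong) (auto simp: algebra_simps)
        then show ?thesis
          unfolding 1 2 r_def[symmetric] by simp
      qed
      have "cmod (coeff P (Suc i) * e i * b (m - i)) \<le> cmod (coeff P (Suc i)) * (\<epsilon> / Suc m * (D * s))"
        if i: "i \<le> m" for i
      proof (cases "i < n")
        case True
        have "of_nat (Suc m) * complex_of_real (p / Suc m) = p"
          by (simp del: of_nat_Suc)
        then have "of_nat (Suc m) * e i
            = of_nat (Suc m) * (1 - a (m - i) ^ Suc i) - of_nat (Suc i) * complex_of_real p"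
          unfolding e_def right_diff_distrib mult.left_commute[of "of_nat (Suc m)" "of_nat (Suc i)"]
          by simp
        then have "real (Suc m) * cmod (e i) < \<epsilon>"
          using N1[of m i] True m by (metis N_def max.boundedE norm_mult norm_of_nat)
        then have "cmod (e i) \<le> \<epsilon> / Suc m"
          by (simp add: field_simps)
        moreover have "cmod (b (m - i)) \<le> D * s"
          unfolding s_def y_def by (rule recover[OF True i])
        ultimately show ?thesis
          unfolding norm_mult mult.assoc using \<epsilon> by (intro mult_left_mono mult_mono) auto
      qed (simp add: degP)
      then have "cmod (\<Sum>i\<le>m. coeff P (Suc i) * e i * b (m - i))
          \<le> (\<Sum>i\<le>m. cmod (coeff P (Suc i)) * (\<epsilon> / Suc m * (D * s)))"
        by (intro order_trans[OF norm_sum] sum_mono) auto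
      also have "\<dots> \<le> W * (\<epsilon> / Suc m * (D * s))"
        unfolding sum_distrib_right[symmetric] using W \<epsilon> D s by (intro mult_right_mono) auto
      also have "\<dots> = (W * \<epsilon> * D) * (s / Suc m)" by simp
      also have "\<dots> \<le> \<eta> * (s / Suc m)"
        using \<epsilon> s by (intro mult_right_mono) auto
      finally show ?thesis
        unfolding eq s_def[symmetric] using norm_triangle_ineq[of "h (Suc m)"] by (smt (verit) times_divide_eq_left times_divide_eq_right)
    qed
    have yN: "(\<Sum>i\<in>I. cmod (y i N)) \<le> E * sqrt S"
      unfolding E_def sum_distrib_right y_def shift_poly_def
    proof (intro sum_mono order_trans[OF norm_sum])
      show "cmod (coeff (Q j) k * b (N - k)) \<le> cmod (coeff (Q j) k) * K (N - k) * sqrt S" for j k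
        unfolding norm_mult mult.assoc by (intro mult_left_mono bK) auto
    qed
    have tail: "(\<Sum>m=N..<M. (cmod (b m))\<^sup>2) \<le> D\<^sup>2 * (C\<^sub>1 * (N * E\<^sup>2 + 1)) * S"
    proof -
      have "(\<Sum>m=N..<M. (cmod (b m))\<^sup>2) \<le> (\<Sum>m=N..<M. (D * (\<Sum>i\<in>I. cmod (y i m)))\<^sup>2)"
        using recover[of 0 _ b] n by (intro sum_mono power_mono) (auto simp: y_def)
      also have "\<dots> = D\<^sup>2 * (\<Sum>m=N..<M. (\<Sum>i\<in>I. cmod (y i m))\<^sup>2)"
        by (simp only: power_mult_distrib sum_distrib_left[symmetric])
      also have "\<dots> \<le> D\<^sup>2 * (C\<^sub>1 * (N * (\<Sum>i\<in>I. cmod (y i N))\<^sup>2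
          + (\<Sum>m=N..<M. (Suc m * cmod (h (Suc m)))\<^sup>2)))"
        by (intro mult_left_mono rot[rule_format]) (use step in \<open>auto simp: N_def\<close>)
      also have "\<dots> \<le> D\<^sup>2 * (C\<^sub>1 * (N * (E * sqrt S)\<^sup>2 + S))"
      proof (intro mult_left_mono add_mono power_mono yN C1)
        have "(\<Sum>m=N..<M. (Suc m * cmod (h (Suc m)))\<^sup>2) \<le> (\<Sum>m<M. (Suc m * cmod (h (Suc m)))\<^sup>2)"
          by (intro sum_mono2) auto
        then show "(\<Sum>m=N..<M. (Suc m * cmod (h (Suc m)))\<^sup>2) \<le> S"
          using S[of M] by linarith
      qed (auto intro: sum_nonneg)
      also have "\<dots> = D\<^sup>2 * (C\<^sub>1 * (N * E\<^sup>2 + 1)) * S"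
        using S0 by (simp add: power_mult_distrib algebra_simps)
      finally show ?thesis .
    qed
    \<comment> \<open>The modes control the solution from \<open>N\<close> on; before \<open>N\<close> only finitely many crude
      constants occur.\<close>
    have head: "(\<Sum>m<N. (cmod (b m))\<^sup>2) \<le> (\<Sum>m<N. (K m)\<^sup>2) * S"
      unfolding sum_distrib_right
    proof (rule sum_mono)
      fix m
      have "(cmod (b m))\<^sup>2 \<le> (K m * sqrt S)\<^sup>2" by (intro power_mono bK) auto
      then show "(cmod (b m))\<^sup>2 \<le> (K m)\<^sup>2 * S" using S0 by (simp add: power_mult_distrib)
    qed
    have "(\<Sum>m<M. (cmod (b m))\<^sup>2) \<le> (\<Sum>m\<in>{..<N} \<union> {N..<M}. (cmod (b m))\<^sup>2)"
      by (intro sum_mono2) auto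
    also have "\<dots> = (\<Sum>m<N. (cmod (b m))\<^sup>2) + (\<Sum>m=N..<M. (cmod (b m))\<^sup>2)"
      by (intro sum.union_disjoint) auto
    finally have "(\<Sum>m<M. (cmod (b m))\<^sup>2) \<le> C * S"
      using head tail by (simp add: C_def distrib_right)
    then show "(\<Sum>m<M. (cmod (triangular_solution A h m))\<^sup>2) \<le> C * S"
      unfolding b_def .
  qed
qed

section \<open>Multiplication by the coordinate function\<close>

text \<open>
  For bounded coefficients the expansion in the \<open>f\<^sub>n\<close> can be rearranged by powers of \<open>z\<close>: it is
  a finite combination, over the degrees occurring in \<open>\<phi>\<close>, of absolutely convergent series. This
  turns identities between functions on the disc into identities between coefficients.
\<close>

lemma basis_expansion_power_series:
  assumes P: "\<And>x. poly P x = phi J w x" and a: "Bseq a" and b: "\<And>n. cmod (b n) \<le> C"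
    and z: "z \<in> ball 0 1"
  shows "\<exists>s. (\<lambda>n. b n * basis_fn J w a n z) sums s
    \<and> (\<lambda>m. (\<Sum>k\<le>m. coeff P k * a (m - k) ^ k * b (m - k)) * z ^ m) sums s"
proof -
  define t where "t = (\<lambda>k n. coeff P k * a n ^ k * b n * z ^ n)"
  obtain B where B: "B > 0" "\<And>n. cmod (a n) \<le> B"
    using a by (auto simp: Bseq_def)
  have C: "C \<ge> 0"
    using b[of 0] norm_ge_zero order_trans by blast
  have t: "summable (t k)" for k
  proof (rule summable_comparison_test')
    show "summable (\<lambda>n. cmod (coeff P k) * B ^ k * C * cmod z ^ n)"
      using z by (intro summable_mult summable_geometric) auto
    show "norm (t k n) \<le> cmod (coeff P k) * B ^ k * C * cmod z ^ n" for n
      unfolding t_def norm_mult norm_power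
      using B b C by (intro mult_mono power_mono) auto
  qed
  define s where "s = (\<Sum>k\<le>degree P. z ^ k * suminf (t k))"
  have "(\<lambda>n. \<Sum>k\<le>degree P. z ^ k * t k n) sums s"
    unfolding s_def by (intro sums_sum sums_mult summable_sums t)
  moreover have "(\<Sum>k\<le>degree P. z ^ k * t k n) = b n * basis_fn J w a n z" for n
    unfolding t_def basis_fn_def P[symmetric] poly_altdef sum_distrib_left
    by (intro sum.cong) (auto simp: power_mult_distrib)
  moreover have "(\<lambda>m. \<Sum>k\<le>degree P. if m < k then 0 else z ^ k * t k (m - k)) sums s"
    unfolding s_def
  proof (rule sums_sum)
    fix k
    have "(\<lambda>n. z ^ k * t k n) sums (z ^ k * suminf (t k))"
      by (intro sums_mult summable_sums t)
    then show "(\<lambda>m. if m < k then 0 else z ^ k * t k (m - k)) sums (z ^ k * suminf (t k))"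
      by (subst sums_zero_iff_shift[of k, symmetric]) auto
  qed
  moreover have "(\<Sum>k\<le>degree P. if m < k then 0 else z ^ k * t k (m - k))
      = (\<Sum>k\<le>m. coeff P k * a (m - k) ^ k * b (m - k)) * z ^ m" for m
    unfolding sum_distrib_right
  proof (rule sum.mono_neutral_cong)
    fix k assume "k \<in> {..degree P} \<inter> {..m}"
    then have "z ^ m = z ^ k * z ^ (m - k)"
      by (simp flip: power_add)
    then show "(if m < k then 0 else z ^ k * t k (m - k)) = coeff P k * a (m - k) ^ k * b (m - k) * z ^ m"
      using \<open>k \<in> {..degree P} \<inter> {..m}\<close> by (auto simp: t_def)
  qed (auto simp: coeff_eq_0)
  ultimately show ?thesis by auto
qed

text \<open>
  The matrix form of the theorem. The sums are the Taylor coefficients of the expansions with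
  coefficients \<open>\<gamma>\<close> and \<open>\<alpha>\<close>, so the conditions say that the former function is \<open>z\<close> times the
  latter. The ansatz is \<open>\<gamma> = b +\<close> the shifted \<open>\<alpha>\<close>, which leaves for \<open>b\<close> the recurrence with
  right-hand side \<open>h\<close>.
\<close>

lemma shifted_coefficients:
  fixes l :: "'i \<Rightarrow> complex" and a :: "nat \<Rightarrow> complex" and p :: real
  assumes I: "finite I" "I \<noteq> {}" and inj: "inj_on l I" and unit: "\<forall>i\<in>I. cmod (l i) = 1"
    and p: "p > 1/2" and a: "(\<lambda>n. of_nat n * (1 - a n)) \<longlonglongrightarrow> complex_of_real p"
  defines "c \<equiv> coeff (lin_prod l I)"
  shows "\<exists>C. \<forall>\<alpha>\<in>l2. \<exists>\<gamma>\<in>l2. l2_norm \<gamma> \<le> C * l2_norm \<alpha> \<and> \<gamma> 0 = 0 \<and>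
    (\<forall>m. (\<Sum>k\<le>Suc m. c k * a (Suc m - k) ^ k * \<gamma> (Suc m - k))
      = (\<Sum>k\<le>m. c k * a (m - k) ^ k * \<alpha> (m - k)))"
proof -
  define A where "A = (\<lambda>i n. c (Suc i) * a n ^ Suc i)"
  define n where "n = card I"
  have c0: "c 0 = 1" by (simp add: c_def coeff_0_lin_prod)
  have degc: "c i = 0" if "i > n" for i
    using degree_lin_prod[OF I(1), of l] that unfolding c_def n_def by (intro coeff_eq_0) simp
  obtain C where C: "C \<ge> 0" and solve: "\<forall>h S M. h 0 = 0 \<longrightarrow>
      (\<forall>M. (\<Sum>m<M. (real (Suc m) * cmod (h (Suc m)))\<^sup>2) \<le> S) \<longrightarrow>
      (\<Sum>m<M. (cmod (triangular_solution A h m))\<^sup>2) \<le> C * S"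
    using recurrence_l2_bound[OF I inj unit p a, folded c_def, folded A_def]
    by (elim exE conjE) (rule that)
  obtain B where B: "\<And>i. B i \<ge> 0"
    "\<And>i m. m \<ge> i \<Longrightarrow> real (Suc m) * cmod (a (m - i) ^ i - a (Suc m - i) ^ i) \<le> B i"
    using dilation_power_difference_bound[OF a] by metis
  define u where "u = (\<lambda>i. cmod (c i) * B i)"
  define W where "W = (\<Sum>i\<le>n. u i)"
  have u: "u i \<ge> 0" for i using B by (simp add: u_def)
  have W: "(\<Sum>i\<le>m. u i) \<le> W" for m
    unfolding W_def by (rule sum_atMost_le_of_support[OF u]) (simp add: u_def degc)
  show ?thesis
  proof (intro exI ballI)
    fix \<alpha> assume \<alpha>: "\<alpha> \<in> l2"
    define F where "F = (\<Sum>n. (cmod (\<alpha> n))\<^sup>2)"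
    have \<alpha>F: "(\<Sum>m<M. (cmod (\<alpha> m))\<^sup>2) \<le> F" for M
      using \<alpha> unfolding F_def l2_def by (intro sum_le_suminf) auto
    define h where "h = (\<lambda>m. case m of 0 \<Rightarrow> 0 | Suc m \<Rightarrow>
      \<Sum>i\<le>m. c i * (a (m - i) ^ i - a (Suc m - i) ^ i) * \<alpha> (m - i))"
    have h: "real (Suc m) * cmod (h (Suc m)) \<le> (\<Sum>i\<le>m. u i * cmod (\<alpha> (m - i)))" for m
    proof -
      have "real (Suc m) * cmod (h (Suc m))
          \<le> real (Suc m) * (\<Sum>i\<le>m. cmod (c i * (a (m - i) ^ i - a (Suc m - i) ^ i) * \<alpha> (m - i)))"
        unfolding h_def by (intro mult_left_mono) (auto intro: norm_sum)
      also have "\<dots> = (\<Sum>i\<le>m. cmod (c i) *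
          (real (Suc m) * cmod (a (m - i) ^ i - a (Suc m - i) ^ i)) * cmod (\<alpha> (m - i)))"
        unfolding sum_distrib_left by (intro sum.cong) (simp_all only: norm_mult mult_ac)
      also have "\<dots> \<le> (\<Sum>i\<le>m. u i * cmod (\<alpha> (m - i)))"
        unfolding u_def by (intro sum_mono mult_right_mono mult_left_mono B) auto
      finally show ?thesis .
    qed
    have hS: "(\<Sum>m<M. (real (Suc m) * cmod (h (Suc m)))\<^sup>2) \<le> W\<^sup>2 * F" for M
    proof -
      have "(\<Sum>m<M. (real (Suc m) * cmod (h (Suc m)))\<^sup>2)
          \<le> (\<Sum>m<M. (\<Sum>i\<le>m. u i * cmod (\<alpha> (m - i)))\<^sup>2)"
        by (intro sum_mono power_mono h) auto
      also have "\<dots> \<le> W\<^sup>2 * (\<Sum>m<M. (cmod (\<alpha> m))\<^sup>2)"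
        by (rule young_l1_l2[OF u W])
      also have "\<dots> \<le> W\<^sup>2 * F"
        by (intro mult_left_mono \<alpha>F) auto
      finally show ?thesis .
    qed
    define b where "b = triangular_solution A h"
    have bF: "(\<Sum>m<M. (cmod (b m))\<^sup>2) \<le> C * (W\<^sup>2 * F)" for M
      unfolding b_def by (rule solve[rule_format, OF _ hS]) (simp add: h_def)
    define \<gamma> where "\<gamma> = (\<lambda>m. b m + (case m of 0 \<Rightarrow> 0 | Suc k \<Rightarrow> \<alpha> k))"
    have b0: "b 0 = 0"
      unfolding b_def by (subst triangular_solution.simps) (simp add: h_def)
    have \<gamma>F: "(\<Sum>m<M. (cmod (\<gamma> m))\<^sup>2) \<le> 2 * (C * W\<^sup>2 + 1) * F" for M
    proof -
      have "(\<Sum>m<M. (cmod (\<gamma> m))\<^sup>2) \<le> (\<Sum>m<Suc M. (cmod (\<gamma> m))\<^sup>2)"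
        by simp
      also have "\<dots> = (\<Sum>m<M. (cmod (\<gamma> (Suc m)))\<^sup>2)"
        by (subst sum.lessThan_Suc_shift) (simp add: \<gamma>_def b0)
      also have "\<dots> \<le> (\<Sum>m<M. 2 * (cmod (b (Suc m)))\<^sup>2 + 2 * (cmod (\<alpha> m))\<^sup>2)"
      proof (rule sum_mono)
        fix m
        have "(cmod (\<gamma> (Suc m)))\<^sup>2 \<le> (cmod (b (Suc m)) + cmod (\<alpha> m))\<^sup>2"
          unfolding \<gamma>_def by (intro power_mono) (auto intro: norm_triangle_ineq)
        also have "\<dots> \<le> 2 * (cmod (b (Suc m)))\<^sup>2 + 2 * (cmod (\<alpha> m))\<^sup>2"
          using sum_squares_bound[of "cmod (b (Suc m))" "cmod (\<alpha> m)"] by (simp add: power2_sum)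
        finally show "(cmod (\<gamma> (Suc m)))\<^sup>2 \<le> 2 * (cmod (b (Suc m)))\<^sup>2 + 2 * (cmod (\<alpha> m))\<^sup>2" .
      qed
      also have "\<dots> = 2 * (\<Sum>m<M. (cmod (b (Suc m)))\<^sup>2) + 2 * (\<Sum>m<M. (cmod (\<alpha> m))\<^sup>2)"
        by (simp add: sum.distrib sum_distrib_left)
      also have "(\<Sum>m<M. (cmod (b (Suc m)))\<^sup>2) = (\<Sum>m<Suc M. (cmod (b m))\<^sup>2)"
        by (subst sum.lessThan_Suc_shift) (simp add: b0)
      finally show ?thesis
        using bF[of "Suc M"] \<alpha>F[of M] by (simp add: algebra_simps)
    qed
    have sum\<gamma>: "summable (\<lambda>m. (cmod (\<gamma> m))\<^sup>2)"
      by (rule summableI_nonneg_bounded[OF _ \<gamma>F]) simp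
    then have "\<gamma> \<in> l2" by (simp add: l2_def)
    have "(\<Sum>m. (cmod (\<gamma> m))\<^sup>2) \<le> 2 * (C * W\<^sup>2 + 1) * F"
      by (rule suminf_le_const[OF sum\<gamma> \<gamma>F])
    then have norm: "l2_norm \<gamma> \<le> sqrt (2 * (C * W\<^sup>2 + 1)) * l2_norm \<alpha>"
      unfolding l2_norm_def F_def[symmetric] real_sqrt_mult[symmetric] by simp
    have "(\<Sum>k\<le>Suc m. c k * a (Suc m - k) ^ k * \<gamma> (Suc m - k))
      = (\<Sum>k\<le>m. c k * a (m - k) ^ k * \<alpha> (m - k))" for m
    proof -
      have "b (Suc m) = h (Suc m) - (\<Sum>i\<le>m. c (Suc i) * a (m - i) ^ Suc i * b (m - i))"
        unfolding b_def by (subst triangular_solution.simps) (simp add: A_def lessThan_Suc_atMost)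
      then have "(\<Sum>k\<le>Suc m. c k * a (Suc m - k) ^ k * b (Suc m - k)) = h (Suc m)"
        by (subst sum.atMost_Suc_shift) (simp add: c0)
      moreover have "(\<Sum>k\<le>Suc m. c k * a (Suc m - k) ^ k * \<gamma> (Suc m - k))
          = (\<Sum>k\<le>Suc m. c k * a (Suc m - k) ^ k * b (Suc m - k))
            + (\<Sum>k\<le>m. c k * a (Suc m - k) ^ k * \<alpha> (m - k))"
        unfolding \<gamma>_def by (simp add: distrib_left sum.distrib Suc_diff_le)
      ultimately show ?thesis
        by (simp add: h_def sum.distrib[symmetric] algebra_simps)
    qed
    moreover have "\<gamma> 0 = 0" by (simp add: \<gamma>_def b0)
    ultimately show "\<exists>\<gamma>\<in>l2. l2_norm \<gamma> \<le> sqrt (2 * (C * W\<^sup>2 + 1)) * l2_norm \<alpha> \<and> \<gamma> 0 = 0 \<and>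
        (\<forall>m. (\<Sum>k\<le>Suc m. c k * a (Suc m - k) ^ k * \<gamma> (Suc m - k))
          = (\<Sum>k\<le>m. c k * a (m - k) ^ k * \<alpha> (m - k)))"
      using \<open>\<gamma> \<in> l2\<close> norm by blast
  qed
qed

theorem theorem17:
  fixes J :: nat and w a :: "nat \<Rightarrow> complex" and p :: real
  assumes "J \<ge> 1"
    and "inj_on w {1..J}"
    and "\<forall>j\<in>{1..J}. cmod (w j) = 1"
    and "\<forall>n. a n \<noteq> 1"
    and "p > 1/2"
    and "(\<lambda>n. of_nat n * (1 - a n)) \<longlonglongrightarrow> complex_of_real p"
  shows "multiplier (\<lambda>z. z) (basis_fn J w a) \<and>
    (\<exists>C. \<forall>g\<in>rkhs (basis_fn J w a).
      rkhs_norm (basis_fn J w a) (\<lambda>z. z * g z) \<le> C * rkhs_norm (basis_fn J w a) g)"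
proof -
  let ?e = "basis_fn J w a"
  define l where "l = (\<lambda>j. cnj (w j))"
  define P where "P = lin_prod l {1..J}"
  have bseq: "Bseq a"
    using dilation_tendsto_1[OF assms(6)] convergentI convergent_imp_Bseq by blast
  have poly: "poly P x = phi J w x" for x
    by (simp add: P_def poly_lin_prod phi_def l_def)
  have inj: "inj_on l {1..J}"
    using assms(2) by (simp only: l_def inj_on_def complex_cnj_cancel_iff)
  have unit: "\<forall>j\<in>{1..J}. cmod (l j) = 1"
    using assms(3) by (simp add: l_def)
  have "\<exists>C. \<forall>\<alpha>\<in>l2. \<exists>\<gamma>\<in>l2. l2_norm \<gamma> \<le> C * l2_norm \<alpha> \<and> \<gamma> 0 = 0 \<and>
    (\<forall>m. (\<Sum>k\<le>Suc m. coeff P k * a (Suc m - k) ^ k * \<gamma> (Suc m - k))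
      = (\<Sum>k\<le>m. coeff P k * a (m - k) ^ k * \<alpha> (m - k)))"
    unfolding P_def
    by (rule shifted_coefficients[OF _ _ inj unit assms(5,6)]) (use assms(1) in simp_all)
  then obtain C where C: "\<forall>\<alpha>\<in>l2. \<exists>\<gamma>\<in>l2. l2_norm \<gamma> \<le> C * l2_norm \<alpha> \<and> \<gamma> 0 = 0 \<and>
    (\<forall>m. (\<Sum>k\<le>Suc m. coeff P k * a (Suc m - k) ^ k * \<gamma> (Suc m - k))
      = (\<Sum>k\<le>m. coeff P k * a (m - k) ^ k * \<alpha> (m - k)))"
    by (elim exE) (rule that)
  have key: "\<exists>\<gamma>. expands ?e \<gamma> (\<lambda>z. z * g z) \<and> l2_norm \<gamma> \<le> C * l2_norm \<alpha>"
    if g: "expands ?e \<alpha> g" for \<alpha> g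
  proof -
    have \<alpha>: "\<alpha> \<in> l2" using g by (simp add: expands_def)
    from C[rule_format, OF \<alpha>] obtain \<gamma> where \<gamma>: "\<gamma> \<in> l2" "l2_norm \<gamma> \<le> C * l2_norm \<alpha>" "\<gamma> 0 = 0"
      "\<forall>m. (\<Sum>k\<le>Suc m. coeff P k * a (Suc m - k) ^ k * \<gamma> (Suc m - k))
        = (\<Sum>k\<le>m. coeff P k * a (m - k) ^ k * \<alpha> (m - k))"
      by (elim bexE conjE) (rule that)
    obtain A where A: "\<And>n. cmod (\<alpha> n) \<le> A" using l2_coeff_bounded[OF \<alpha>] by metis
    obtain G where G: "\<And>n. cmod (\<gamma> n) \<le> G" using l2_coeff_bounded[OF \<gamma>(1)] by metis
    have "(\<lambda>n. \<gamma> n * ?e n z) sums (z * g z)" if z: "z \<in> ball 0 1" for z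
    proof -
      define q where "q = (\<lambda>m. \<Sum>k\<le>m. coeff P k * a (m - k) ^ k * \<alpha> (m - k))"
      define r where "r = (\<lambda>m. \<Sum>k\<le>m. coeff P k * a (m - k) ^ k * \<gamma> (m - k))"
      obtain s where s: "(\<lambda>n. \<alpha> n * ?e n z) sums s" "(\<lambda>m. q m * z ^ m) sums s"
        using basis_expansion_power_series[where b = \<alpha>, OF poly bseq A z] unfolding q_def by blast
      obtain s' where s': "(\<lambda>n. \<gamma> n * ?e n z) sums s'" "(\<lambda>m. r m * z ^ m) sums s'"
        using basis_expansion_power_series[where b = \<gamma>, OF poly bseq G z] unfolding r_def by blast
      have "s = g z"
        using s(1) g z sums_unique2 unfolding expands_def by blast
      have "(\<lambda>m. z * (q m * z ^ m)) sums (z * s)"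
        by (rule sums_mult[OF s(2)])
      then have "(\<lambda>m. r (Suc m) * z ^ Suc m) sums (z * s)"
        unfolding r_def \<gamma>(4)[rule_format] q_def by (simp add: mult_ac)
      then have "(\<lambda>m. r m * z ^ m) sums (z * s)"
        by (subst (asm) sums_Suc_iff) (simp add: r_def \<gamma>(3))
      then have "s' = z * s"
        using s'(2) sums_unique2 by blast
      then show ?thesis using s'(1) \<open>s = g z\<close> by simp
    qed
    then show ?thesis using \<gamma>(1,2) by (auto simp: expands_def)
  qed
  have "multiplier (\<lambda>z. z) ?e"
    unfolding multiplier_def rkhs_def using key by blast
  moreover have "rkhs_norm ?e (\<lambda>z. z * g z) \<le> C * rkhs_norm ?e g" if "g \<in> rkhs ?e" for g
  proof -
    from that obtain \<alpha> where \<alpha>: "expands ?e \<alpha> g" by (auto simp: rkhs_def)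
    from key[OF \<alpha>] obtain \<gamma> where "expands ?e \<gamma> (\<lambda>z. z * g z)" "l2_norm \<gamma> \<le> C * l2_norm \<alpha>"
      by blast
    then show ?thesis
      unfolding rkhs_norm_def using rkhs_coeffs_eq[OF assms(3) bseq] \<alpha> by simp
  qed
  ultimately show ?thesis by blast
qed

end
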